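(* Let $M$ be a positive integer congruent to $1$, $4$ or $7$ modulo $8$, and let $n\ge 1$ and $k\ge 0$ be integers. The number of partitions of $n$ into parts congruent to $1$, $4$ or $7$ modulo $8$ in which the part $M$ occurs exactly $k$ times is equal to the number of partitions $\lambda=(\lambda_1\ge\lambda_2\ge\cdots)$ of $n$ into parts whose difference is at least $2$, and greater than $2$ for consecutive even parts, such that: (1) if $\lambda$ has a single part, then $\lfloor n/M\rfloor=k$; (2) if $\lambda$ has at least two parts and the second part $\lambda_2$ is even, then $\lfloor (\lambda_1-\lambda_2-3)/M\rfloor=k$; (3) if $\lambda$ has at least two parts and the second part $\lambda_2$ is odd, then $\lfloor(\lambda_1-\lambda_2-2)/M\rfloor=k$.
   Context: The phrase "parts whose difference is at least $2$, and greater than $2$ for consecutive even parts" means: $\lambda_i-\lambda_{i+1}\ge 2$ for every pair of successive parts, and $\lambda_i-\lambda_{i+1}>2$ whenever $\lambda_i$ and $\lambda_{i+1}$ are both even. *)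

theory Defs
  imports Complex_Main
begin

(* A partition is the weakly decreasing list of its parts: \<lambda>_1, \<lambda>_2, ... are xs ! 0, xs ! 1, ... *)
definition partitions :: "nat \<Rightarrow> nat list set" where
  "partitions n = {xs. sorted_wrt (\<ge>) xs \<and> (\<forall>x \<in> set xs. x > 0) \<and> sum_list xs = n}"

definition parts_1_4_7_mod_8 :: "nat list \<Rightarrow> bool" where
  "parts_1_4_7_mod_8 xs \<longleftrightarrow> (\<forall>x \<in> set xs. x mod 8 \<in> {1, 4, 7})"

definition gap_condition :: "nat list \<Rightarrow> bool" where
  "gap_condition xs \<longleftrightarrow>
     (\<forall>i. Suc i < length xs \<longrightarrow>
        int (xs ! i) - int (xs ! Suc i) \<ge> 2 \<and>
        (even (xs ! i) \<and> even (xs ! Suc i) \<longrightarrow> int (xs ! i) - int (xs ! Suc i) > 2))"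

(* Not used in the statement: shows that card is never applied to an infinite set there. *)
lemma finite_partitions: "finite (partitions n)"
proof (rule finite_subset)
  show "partitions n \<subseteq> {xs. set xs \<subseteq> {..n} \<and> length xs \<le> n}"
  proof
    fix xs assume "xs \<in> partitions n"
    then have pos: "\<forall>x \<in> set xs. x > 0" and sum: "sum_list xs = n"
      by (auto simp: partitions_def)
    from pos have "length xs \<le> sum_list xs"
      by (induction xs) auto
    moreover have "set xs \<subseteq> {..n}"
      using member_le_sum_list sum by auto
    ultimately show "xs \<in> {xs. set xs \<subseteq> {..n} \<and> length xs \<le> n}"
      using sum by simp
  qed
  show "finite {xs. set xs \<subseteq> {..n} \<and> length xs \<le> n}"
    by (rule finite_lists_length_le) simp
qed

end

theory Submission
  imports Defs "HOL-Computational_Algebra.Formal_Power_Series" "HOL-Library.Multiset"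
begin

text \<open>
  Both sides are differences of tail counts, because an integer-valued function equals k exactly when
  it is at least k but not at least k + 1.  Deleting k copies of M shows that the partitions of n into
  parts 1, 4, 7 modulo 8 with at least k parts M are equinumerous with all such partitions of n - kM.
  On the other side, the floor in the statement is at least k exactly when kM may be subtracted from
  the largest part without violating the gap condition (a single part may shrink to nothing).  Hence
  the partitions concerned correspond to all gap partitions of n - kM.  The theorem thus
  reduces to the Goellnitz-Gordon identity \<open>goellnitz_gordon\<close>: the two unrefined kinds of partitions
  are equinumerous for every n.

  Write (a; p)_n for the product of 1 - a p^i over i < n, and (a; p) for the infinite product.  Classifying gap partitions by their smallest
  part shows (\<open>gg_sum_nth\<close>) that their generating function is the sum over s of
  q^(s^2) (-q; q^2)_s / (q^2; q^2)_s.  That this is 1 / ((q; q^8) (q^4; q^8) (q^7; q^8)) is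
  proved by a finite form of the Bailey chain with base p = q^2.  A seed identity, whose product side
  for s > 0 contains the factor 1 - 1, says that the sum over t of (-1)^t p^(t(t-1)/2) / ((p; p)_(s-t) (p; p)_(s+t))
  is 0 unless s = 0.  Each application of \<open>bailey_lemma\<close>, which is the q-Chu-Vandermonde summation in
  disguise, multiplies the t-th term by a power of q; two applications lead from the seed to
  \<open>finite_goellnitz_gordon\<close>, an exact identity whose right-hand side carries the theta
  terms (-1)^t q^(4t^2-t).  As the bound N grows, the remaining factors stabilise modulo q^N, and the
  finite form of Jacobi's triple product (\<open>finite_triple_product\<close>, in base q^8) evaluates the theta
  series.  What is left is to collect infinite products by residue classes modulo 8.

  Infinite products stand for congruences modulo q^N between formal power series: all sums and products
  below are finite.
\<close>

section \<open>Pochhammer symbols in formal power series\<close>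

text \<open>
  The q-Pochhammer symbol (a; p)_n.
\<close>

definition qpoch :: "'a::comm_ring_1 \<Rightarrow> 'a \<Rightarrow> nat \<Rightarrow> 'a" where
  "qpoch a p n = (\<Prod>i<n. 1 - a * p ^ i)"

text \<open>
  The reciprocal of (p; p)_n.  Extending it by 0 to negative n is the usual convention that makes
  \<open>inv_qpoch_rec\<close> hold at n = 0 as well, so that sums over t containing
  1 / ((p; p)_(N-t) (p; p)_(N+t)) break off by themselves.
\<close>

definition inv_qpoch :: "rat fps \<Rightarrow> int \<Rightarrow> rat fps" where
  "inv_qpoch p n = (if n < 0 then 0 else inverse (qpoch p p (nat n)))"

lemma qpoch_0 [simp]: "qpoch a p 0 = 1"
  by (simp add: qpoch_def)

lemma qpoch_Suc: "qpoch a p (Suc n) = qpoch a p n * (1 - a * p ^ n)"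
  by (simp add: qpoch_def)

lemma qpoch_nth_0: "fps_nth a 0 = 0 \<Longrightarrow> fps_nth (qpoch a p n) 0 = (1::rat)"
  by (induction n) (simp_all add: qpoch_Suc)

lemma inv_qpoch_neg: "n < 0 \<Longrightarrow> inv_qpoch p n = 0"
  by (simp add: inv_qpoch_def)

lemma inv_qpoch_0 [simp]: "inv_qpoch p 0 = 1"
  by (simp add: inv_qpoch_def)

lemma qpoch_inv_qpoch:
  assumes "fps_nth p 0 = 0"
  shows "qpoch p p n * inv_qpoch p (int n) = 1"
  by (simp add: inv_qpoch_def inverse_mult_eq_1' qpoch_nth_0 assms)

lemma inv_qpoch_rec:
  assumes "fps_nth p 0 = 0" "n \<ge> 0"
  shows "inv_qpoch p (n - 1) = (1 - p ^ nat n) * inv_qpoch p n"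
proof (cases "n = 0")
  case False
  define m where "m = nat n - 1"
  have n: "n = int (Suc m)" using False assms(2) by (simp add: m_def)
  have 1: "fps_nth (1 - p * p ^ m) 0 \<noteq> 0"
    using assms(1) by simp
  show ?thesis
    unfolding n inv_qpoch_def
    by (simp add: qpoch_Suc fps_inverse_mult nat_add_distrib)
       (metis (no_types, lifting) "1" inverse_mult_eq_1' mult.assoc mult.commute mult.left_neutral)
qed (simp add: inv_qpoch_neg)

lemma inv_qpoch_Suc:
  assumes "fps_nth p 0 = 0"
  shows "inv_qpoch p (int k) = (1 - p ^ Suc k) * inv_qpoch p (int (Suc k))"
  using inv_qpoch_rec[OF assms, of "int (Suc k)"] by (simp del: of_nat_Suc power_Suc add: nat_int) simp

section \<open>The finite Jacobi triple product\<close>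

text \<open>
  The t-th term of the theta series to base p = q^(\<alpha>+\<beta>), namely
  (-1)^t q^(\<alpha> t) p^(t(t-1)/2).  The exponent is never negative (\<open>theta_term_exponent_nonneg\<close>), so the conversion to a
  natural number loses nothing.  Only two cases matter later: \<alpha> = 0, \<beta> = 2 gives
  (-1)^t q^(t(t-1)), and \<alpha> = 3, \<beta> = 5 gives (-1)^t q^(4t^2-t).
\<close>

definition theta_term :: "rat fps \<Rightarrow> nat \<Rightarrow> nat \<Rightarrow> int \<Rightarrow> rat fps" where
  "theta_term q \<alpha> \<beta> t = (-1) ^ nat \<bar>t\<bar> * q ^ nat (int (\<alpha> + \<beta>) * (t * (t - 1) div 2) + int \<alpha> * t)"

lemma triangle_step: "(t + 1) * t div 2 = t * (t - 1) div 2 + (t::int)"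
proof -
  have "(t + 1) * t = t * (t - 1) + t * 2" by (simp add: algebra_simps)
  then show ?thesis by simp
qed

lemma triangle_neg: "(- t) * (- t - 1) div 2 = t * (t - 1) div 2 + (t::int)"
  using triangle_step[of t] by (simp add: algebra_simps)

lemma triangle_nonneg: "(t * (t - 1) div 2 :: int) \<ge> 0"
proof -
  have "t * (t - 1) \<ge> 0" by (cases "t \<ge> 1") (auto intro: mult_nonneg_nonneg mult_nonpos_nonpos)
  then show ?thesis by simp
qed

lemma theta_term_exponent_nonneg: "int (\<alpha> + \<beta>) * (t * (t - 1) div 2) + int \<alpha> * t \<ge> 0"
proof (cases "t \<ge> 0")
  case True
  then show ?thesis using triangle_nonneg[of t] by simp
next
  case False
  have *: "t * (t - 1) div 2 + t \<ge> 0"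
    using triangle_nonneg[of "-t"] triangle_neg[of t] by simp
  have "int (\<alpha> + \<beta>) * (t * (t - 1) div 2) + int \<alpha> * t =
    int \<beta> * (t * (t - 1) div 2) + int \<alpha> * (t * (t - 1) div 2 + t)"
    by (simp add: algebra_simps)
  also have "\<dots> \<ge> 0" using * triangle_nonneg[of t] by simp
  finally show ?thesis .
qed

lemma theta_term_0 [simp]: "theta_term q \<alpha> \<beta> 0 = 1"
  by (simp add: theta_term_def)

lemma theta_term_reflect: "theta_term q \<alpha> \<beta> (- t) = theta_term q \<beta> \<alpha> t"
  unfolding theta_term_def triangle_neg by (simp add: algebra_simps)

text \<open>
  The quotient of consecutive theta terms is - q^\<alpha> p^t.  The factor p^(N-t) on the left keeps all
  exponents natural and is the one that arises from Pascal's rule in \<open>finite_triple_product_step\<close>.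
\<close>

lemma theta_term_step:
  assumes "t \<le> int N"
  shows "theta_term q \<alpha> \<beta> (t + 1) * (q ^ (\<alpha> + \<beta>)) ^ nat (int N - t)
    = - (q ^ \<alpha> * (q ^ (\<alpha> + \<beta>)) ^ N * theta_term q \<alpha> \<beta> t)"
proof -
  define e where "e t = int (\<alpha> + \<beta>) * (t * (t - 1) div 2) + int \<alpha> * t" for t
  have e: "e t \<ge> 0" for t unfolding e_def by (rule theta_term_exponent_nonneg)
  have "e (t + 1) = e t + int (\<alpha> + \<beta>) * t + int \<alpha>"
    using triangle_step[of t] by (simp add: e_def algebra_simps)
  (* compare exponents as integers, where t = N - d may be negative *)
  moreover define d where "d = nat (int N - t)"
  have d: "int d = int N - t" using assms by (simp add: d_def)
  ultimately have "int (nat (e (t + 1)) + (\<alpha> + \<beta>) * d) = int (\<alpha> + (\<alpha> + \<beta>) * N + nat (e t))"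
    using e[of t] e[of "t + 1"] by (simp add: d algebra_simps)
  then have x: "nat (e (t + 1)) + (\<alpha> + \<beta>) * d = \<alpha> + (\<alpha> + \<beta>) * N + nat (e t)"
    by (simp only: of_nat_eq_iff)
  have s: "(-1) ^ nat \<bar>t + 1\<bar> = - ((-1) ^ nat \<bar>t\<bar> :: rat fps)"
  proof (cases "t \<ge> 0")
    case True
    then have "nat \<bar>t + 1\<bar> = Suc (nat \<bar>t\<bar>)" by linarith
    then show ?thesis by (simp only: power_Suc mult_minus1 minus_minus)
  next
    case False
    then have "nat \<bar>t\<bar> = Suc (nat \<bar>t + 1\<bar>)" by linarith
    then show ?thesis by (simp only: power_Suc mult_minus1 minus_minus)
  qed
  have dd: "nat (int N - t) = d" using d by simp
  have "theta_term q \<alpha> \<beta> (t + 1) * (q ^ (\<alpha> + \<beta>)) ^ d = (-1) ^ nat \<bar>t + 1\<bar> * q ^ (nat (e (t + 1)) + (\<alpha> + \<beta>) * d)"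
    unfolding theta_term_def e_def by (simp only: power_add power_mult mult.assoc)
  also have "\<dots> = - (q ^ \<alpha> * (q ^ (\<alpha> + \<beta>)) ^ N * theta_term q \<alpha> \<beta> t)"
    unfolding x s unfolding theta_term_def e_def by (simp only: power_add power_mult mult.assoc) (simp add: ac_simps)
  finally show ?thesis unfolding dd .
qed

text \<open>
  Pascal's rule for the Gaussian binomial coefficient, applied to each term: in
  1 - p^(N+M+1) = (1 - p^(N+1-t)) + p^(N+1-t) (1 - p^(M+t))
  the first summand lowers N + 1 - t and the second lowers M + t.  The second family of terms is the
  first one shifted by one in t, up to the factor - q^\<alpha> p^N.
\<close>

lemma finite_triple_product_step:
  fixes q :: "rat fps" and M N :: nat
  assumes "fps_nth q 0 = 0" "\<alpha> + \<beta> > 0"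
  defines "p \<equiv> q ^ (\<alpha> + \<beta>)"
  defines "F \<equiv> \<lambda>N. \<Sum>t = - int M..int N. theta_term q \<alpha> \<beta> t * inv_qpoch p (int N - t) * inv_qpoch p (int M + t)"
  shows "(1 - p ^ Suc (N + M)) * F (Suc N) = (1 - q ^ \<alpha> * p ^ N) * F N"
proof -
  have p0: "fps_nth p 0 = 0" using assms by (simp add: p_def fps_power_zeroth)
  let ?f = "\<lambda>t. theta_term q \<alpha> \<beta> t * inv_qpoch p (int N - t) * inv_qpoch p (int M + t)"
  let ?g = "\<lambda>t. theta_term q \<alpha> \<beta> t * p ^ nat (int N + 1 - t) * inv_qpoch p (int N + 1 - t) * inv_qpoch p (int M + t - 1)"
  have split: "(1 - p ^ Suc (N + M)) * (theta_term q \<alpha> \<beta> t * inv_qpoch p (int (Suc N) - t) * inv_qpoch p (int M + t)) = ?f t + ?g t"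
    if "t \<in> {- int M..int N + 1}" for t
  proof -
    have "Suc (N + M) = nat (int N + 1 - t) + nat (int M + t)" using that by auto
    then have "1 - p ^ Suc (N + M) = (1 - p ^ nat (int N + 1 - t)) + p ^ nat (int N + 1 - t) * (1 - p ^ nat (int M + t))"
      by (simp add: power_add algebra_simps)
    moreover have "inv_qpoch p (int N - t) = (1 - p ^ nat (int N + 1 - t)) * inv_qpoch p (int N + 1 - t)"
      using inv_qpoch_rec[OF p0, of "int N + 1 - t"] that by simp
    moreover have "inv_qpoch p (int M + t - 1) = (1 - p ^ nat (int M + t)) * inv_qpoch p (int M + t)"
      using inv_qpoch_rec[OF p0, of "int M + t"] that by simp
    moreover have "int (Suc N) - t = int N + 1 - t" by simp
    ultimately show ?thesis by (simp only: ) (simp add: algebra_simps)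
  qed
  have "(1 - p ^ Suc (N + M)) * F (Suc N) = (\<Sum>t = - int M..int N + 1. ?f t + ?g t)"
    unfolding F_def sum_distrib_left by (rule sum.cong) (use split in \<open>auto simp: add.commute\<close>)
  also have "\<dots> = (\<Sum>t = - int M..int N + 1. ?f t) + (\<Sum>t = - int M..int N + 1. ?g t)"
    by (rule sum.distrib)
  also have "(\<Sum>t = - int M..int N + 1. ?f t) = F N"
    unfolding F_def by (rule sum.mono_neutral_right) (auto simp: inv_qpoch_neg)
  also have "(\<Sum>t = - int M..int N + 1. ?g t) = (\<Sum>t = - int M + 1..int N + 1. ?g t)"
    by (rule sum.mono_neutral_right) (auto simp: inv_qpoch_neg)
  also have "\<dots> = (\<Sum>t = - int M..int N. ?g (t + 1))"
    by (rule sum.reindex_bij_witness[of _ "\<lambda>t. t + 1" "\<lambda>t. t - 1"]) auto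
  also have "\<dots> = (\<Sum>t = - int M..int N. - (q ^ \<alpha> * p ^ N) * ?f t)"
  proof (rule sum.cong)
    fix t assume "t \<in> {- int M..int N}"
    then have "theta_term q \<alpha> \<beta> (t + 1) * p ^ nat (int N - t) = - (q ^ \<alpha> * p ^ N * theta_term q \<alpha> \<beta> t)"
      unfolding p_def by (intro theta_term_step) auto
    moreover have "int N + 1 - (t + 1) = int N - t" "int M + (t + 1) - 1 = int M + t" by auto
    ultimately show "?g (t + 1) = - (q ^ \<alpha> * p ^ N) * ?f t"
      by (simp only:) (simp add: algebra_simps)
  qed simp
  also have "\<dots> = - (q ^ \<alpha> * p ^ N) * F N"
    unfolding F_def by (rule sum_distrib_left[symmetric])
  finally show ?thesis by (simp add: algebra_simps)
qed

text \<open>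
  The q-binomial theorem in Cauchy's symmetric form; the limit of large N and M is Jacobi's triple
  product.  The step lemma enlarges N, and the reflection of t, which exchanges \<alpha> with \<beta> and N
  with M, reduces the growth of M to the same lemma.
\<close>

lemma finite_triple_product:
  fixes q :: "rat fps" and M N :: nat
  assumes q0: "fps_nth q 0 = 0" and ab: "\<alpha> + \<beta> > 0"
  defines "p \<equiv> q ^ (\<alpha> + \<beta>)"
  shows "(\<Sum>t = - int M..int N. theta_term q \<alpha> \<beta> t * inv_qpoch p (int N - t) * inv_qpoch p (int M + t))
    = qpoch (q ^ \<alpha>) p N * qpoch (q ^ \<beta>) p M * inv_qpoch p (int (N + M))"
proof -
  define F where "F \<alpha> \<beta> N M = (\<Sum>t = - int M..int N. theta_term q \<alpha> \<beta> t * inv_qpoch p (int N - t) * inv_qpoch p (int M + t))" for \<alpha> \<beta> N M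
  have p0: "fps_nth p 0 = 0" using q0 ab by (simp add: p_def fps_power_zeroth)
  (* The step lemma in a form without division: the factor 1 - p^(N+M+1) is the quotient of two
     consecutive reciprocals. *)
  have step: "F a b (Suc N) M * inv_qpoch p (int (N + M)) = (1 - q ^ a * p ^ N) * F a b N M * inv_qpoch p (int (Suc N + M))"
    if "a + b = \<alpha> + \<beta>" for a b N M
  proof -
    have "(1 - p ^ Suc (N + M)) * F a b (Suc N) M = (1 - q ^ a * p ^ N) * F a b N M"
      using finite_triple_product_step[OF q0, of a b N M] that ab unfolding F_def p_def by simp
    moreover have "inv_qpoch p (int (N + M)) = (1 - p ^ Suc (N + M)) * inv_qpoch p (int (Suc N + M))"
      using inv_qpoch_Suc[OF p0, of "N + M"] by simp
    ultimately show ?thesis by (simp only: ) (metis mult.assoc mult.commute)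
  qed
  have grow: "F a b N M = qpoch (q ^ a) p N * (F a b 0 M * qpoch p p M) * inv_qpoch p (int (N + M))"
    if "a + b = \<alpha> + \<beta>" for a b N M
  proof (induction N)
    case 0
    then show ?case using qpoch_inv_qpoch[OF p0, of M] by (simp add: mult.assoc)
  next
    case (Suc N)
    have "F a b (Suc N) M = F a b (Suc N) M * inv_qpoch p (int (N + M)) * qpoch p p (N + M)"
      using qpoch_inv_qpoch[OF p0, of "N + M"] by (simp only: mult.assoc) (simp add: mult.commute)
    also have "\<dots> = (1 - q ^ a * p ^ N) * qpoch (q ^ a) p N * (F a b 0 M * qpoch p p M) * inv_qpoch p (int (Suc N + M))
      * (qpoch p p (N + M) * inv_qpoch p (int (N + M)))"
      unfolding step[OF that] Suc.IH by (simp only: ac_simps)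
    finally show ?case unfolding qpoch_inv_qpoch[OF p0] by (simp add: qpoch_Suc ac_simps)
  qed
  have reflect: "F a b N M = F b a M N" for a b N M
    unfolding F_def
    by (rule sum.reindex_bij_witness[of _ uminus uminus]) (auto simp: theta_term_reflect ac_simps)
  have "F \<beta> \<alpha> 0 0 = 1" by (simp add: F_def)
  then have "F \<alpha> \<beta> 0 M = qpoch (q ^ \<beta>) p M * inv_qpoch p (int M)"
    using grow[of \<beta> \<alpha> M 0] by (subst reflect) (simp add: add.commute)
  then have "F \<alpha> \<beta> 0 M * qpoch p p M = qpoch (q ^ \<beta>) p M"
    using qpoch_inv_qpoch[OF p0, of M] by (simp add: mult.assoc mult.commute)
  then show ?thesis using grow[of \<alpha> \<beta> N M] unfolding F_def by (simp add: mult.assoc)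
qed

section \<open>The Bailey chain\<close>

text \<open>
  The q-Chu-Vandermonde summation, in a homogeneous form that allows A = 0.
  Induction on n by Pascal's rule: the sum for n + 1 is the sum for n plus p^n (A + p^(m+1)) times the sum for n
  and m + 1, and 1 - p^(n+m+1) + p^n (A + p^(m+1)) = 1 + A p^n.
\<close>

lemma q_chu_vandermonde:
  assumes p0: "fps_nth p 0 = 0"
  shows "(\<Sum>r\<le>n. inv_qpoch p (int (n - r)) * inv_qpoch p (int r) * (\<Prod>i<r. A + p ^ (m + i + 1)) * p ^ (r choose 2) * inv_qpoch p (int (m + r)))
    = (\<Prod>i<n. 1 + A * p ^ i) * inv_qpoch p (int n) * inv_qpoch p (int (n + m))"
proof (induction n arbitrary: m)
  case 0
  then show ?case by (simp add: numeral_2_eq_2)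
next
  case (Suc n)
  note rec = inv_qpoch_Suc[OF p0]
  let ?h = "\<lambda>m r. (\<Prod>i<r. A + p ^ (m + i + 1)) * p ^ (r choose 2) * inv_qpoch p (int (m + r))"
  let ?E = "\<lambda>k. inv_qpoch p (int k)"
  let ?S = "\<lambda>n m. \<Sum>r\<le>n. ?E (n - r) * ?E r * ?h m r"
  let ?u = "\<lambda>r. if r \<le> n then ?E (n - r) * ?E r * ?h m r else 0"
  let ?v = "\<lambda>r. p ^ (Suc n - r) * ?E (Suc n - r) * (if r = 0 then 0 else ?E (r - 1)) * ?h m r"
  have "(1 - p ^ Suc n) * (?E (Suc n - r) * ?E r * ?h m r) = ?u r + ?v r" if "r \<le> Suc n" for r
  proof -
    have a: "(1 - p ^ (Suc n - r)) * ?E (Suc n - r) = (if r \<le> n then ?E (n - r) else 0)"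
      using that rec[of "n - r"] by (cases "r \<le> n") (simp_all only: Suc_diff_le if_True if_False, simp)
    have b: "(1 - p ^ r) * ?E r = (if r = 0 then 0 else ?E (r - 1))"
      using rec[of "r - 1"] by (cases r) auto
    have "p ^ Suc n = p ^ (Suc n - r) * p ^ r"
      using that by (metis le_add_diff_inverse2 power_add)
    then have "(1 - p ^ Suc n) = (1 - p ^ (Suc n - r)) + p ^ (Suc n - r) * (1 - p ^ r)"
      by (simp add: algebra_simps)
    then have "(1 - p ^ Suc n) * (?E (Suc n - r) * ?E r * ?h m r) =
      ((1 - p ^ (Suc n - r)) * ?E (Suc n - r)) * ?E r * ?h m r + p ^ (Suc n - r) * ?E (Suc n - r) * ((1 - p ^ r) * ?E r) * ?h m r"
      by (simp only: ) (simp only: ring_distribs ac_simps)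
    then show ?thesis unfolding a b by simp
  qed
  then have "(1 - p ^ Suc n) * ?S (Suc n) m = (\<Sum>r\<le>Suc n. ?u r + ?v r)"
    unfolding sum_distrib_left by (intro sum.cong) auto
  also have "\<dots> = (\<Sum>r\<le>Suc n. ?u r) + (\<Sum>r\<le>Suc n. ?v r)" by (rule sum.distrib)
  also have "(\<Sum>r\<le>Suc n. ?u r) = ?S n m" by simp
  also have "(\<Sum>r\<le>Suc n. ?v r) = (\<Sum>r\<le>n. ?v (Suc r))"
    by (subst sum.atMost_Suc_shift) simp
  also have "\<dots> = (\<Sum>r\<le>n. p ^ n * (A + p ^ Suc m) * (?E (n - r) * ?E r * ?h (Suc m) r))"
  proof (rule sum.cong)
    fix r assume "r \<in> {..n}"
    then have r: "r \<le> n" by simp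
    have e: "p ^ n * p ^ (r choose 2) = p ^ (n - r) * p ^ (Suc r choose 2)"
      using r by (simp add: numeral_2_eq_2 flip: power_add)
    have pr: "(\<Prod>i<Suc r. A + p ^ (m + i + 1)) = (A + p ^ Suc m) * (\<Prod>i<r. A + p ^ (Suc m + i + 1))"
      by (subst prod.lessThan_Suc_shift) simp
    have "?v (Suc r) = p ^ (n - r) * p ^ (Suc r choose 2) * ?E (n - r) * ?E r * (A + p ^ Suc m) * (\<Prod>i<r. A + p ^ (Suc m + i + 1)) * ?E (m + Suc r)"
      unfolding pr by (simp only: diff_Suc_Suc diff_Suc_1 if_False nat.distinct ac_simps)
    then show "?v (Suc r) = p ^ n * (A + p ^ Suc m) * (?E (n - r) * ?E r * ?h (Suc m) r)"
      unfolding e[symmetric] by (simp add: ac_simps)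
  qed simp
  also have "\<dots> = p ^ n * (A + p ^ Suc m) * ?S n (Suc m)"
    by (rule sum_distrib_left[symmetric])
  also have "?S n m = (\<Prod>i<n. 1 + A * p ^ i) * ?E n * ?E (n + m)"
    using Suc.IH[of m] by (simp only: mult.assoc)
  also have "?S n (Suc m) = (\<Prod>i<n. 1 + A * p ^ i) * ?E n * ?E (n + Suc m)"
    using Suc.IH[of "Suc m"] by (simp only: mult.assoc)
  also have "?E (n + m) = (1 - p ^ Suc (n + m)) * ?E (Suc (n + m))" by (rule rec)
  also have "(\<Prod>i<n. 1 + A * p ^ i) * ?E n * ((1 - p ^ Suc (n + m)) * ?E (Suc (n + m))) +
    p ^ n * (A + p ^ Suc m) * ((\<Prod>i<n. 1 + A * p ^ i) * ?E n * ?E (n + Suc m))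
    = (\<Prod>i<Suc n. 1 + A * p ^ i) * ?E n * ?E (Suc n + m)"
    by (simp add: algebra_simps power_add)
  also have "?E n = (1 - p ^ Suc n) * ?E (Suc n)" by (rule rec)
  finally have "(1 - p ^ Suc n) * ?S (Suc n) m = (1 - p ^ Suc n) * ((\<Prod>i<Suc n. 1 + A * p ^ i) * ?E (Suc n) * ?E (Suc n + m))"
    by (simp only: ac_simps)
  (* its constant term is 1, so the common factor may be cancelled *)
  moreover have "1 - p ^ Suc n \<noteq> 0"
  proof
    assume "1 - p ^ Suc n = 0"
    then have "fps_nth (1 - p ^ Suc n) 0 = 0" by simp
    then show False using p0 by simp
  qed
  ultimately have "?S (Suc n) m = (\<Prod>i<Suc n. 1 + A * p ^ i) * ?E (Suc n) * ?E (Suc n + m)"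
    using mult_left_cancel by blast
  then show ?case by (simp only: mult.assoc)
qed

lemma choose_two_add: "(t + r) choose 2 = (t choose 2) + (r choose 2) + t * r"
  by (induction r) (simp_all add: numeral_2_eq_2)

lemma prod_lessThan_add: "(\<Prod>i<t + r. f i) = (\<Prod>i<t. f i) * (\<Prod>i<r. f (t + i :: nat))"
  by (induction r) (simp_all add: mult.assoc)

text \<open>
  After the substitution s = t + r this is \<open>q_chu_vandermonde\<close> with A p^t and 2t in place of A and m.
\<close>

lemma bailey_kernel:
  assumes p0: "fps_nth p 0 = 0"
  shows "(\<Sum>s\<le>N. (\<Prod>i<s. A + p ^ (i + 1)) * p ^ (s choose 2) * inv_qpoch p (int (N - s)) *
        (inv_qpoch p (int s - int t) * inv_qpoch p (int s + int t)))
    = (\<Prod>i<t. A + p ^ (i + 1)) * p ^ (t choose 2) * (\<Prod>i=t..<N. 1 + A * p ^ i) *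
        (inv_qpoch p (int N - int t) * inv_qpoch p (int N + int t))"
proof (cases "t \<le> N")
  case False
  then show ?thesis by (auto simp: inv_qpoch_neg intro!: sum.neutral)
next
  case True
  then obtain n where n: "N = t + n" using le_Suc_ex by blast
  let ?f = "\<lambda>s. (\<Prod>i<s. A + p ^ (i + 1)) * p ^ (s choose 2) * inv_qpoch p (int (N - s)) *
        (inv_qpoch p (int s - int t) * inv_qpoch p (int s + int t))"
  let ?c = "(\<Prod>i<t. A + p ^ (i + 1)) * p ^ (t choose 2)"
  have "sum ?f {..N} = sum ?f {t..N}"
    by (rule sum.mono_neutral_right) (auto simp: inv_qpoch_neg)
  also have "\<dots> = (\<Sum>r\<le>n. ?f (t + r))"
    by (rule sum.reindex_bij_witness[of _ "\<lambda>r. t + r" "\<lambda>s. s - t"]) (auto simp: n)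
  also have "\<dots> = (\<Sum>r\<le>n. ?c * (inv_qpoch p (int (n - r)) * inv_qpoch p (int r) *
      (\<Prod>i<r. A * p ^ t + p ^ (2 * t + i + 1)) * p ^ (r choose 2) * inv_qpoch p (int (2 * t + r))))"
  proof (rule sum.cong)
    fix r assume "r \<in> {..n}"
    have "(\<Prod>i<r. A * p ^ t + p ^ (2 * t + i + 1)) = (\<Prod>i<r. p ^ t * (A + p ^ (t + i + 1)))"
      by (simp only: mult_2 power_add) (simp only: ring_distribs ac_simps)
    also have "\<dots> = p ^ (t * r) * (\<Prod>i<r. A + p ^ (t + i + 1))"
      by (simp add: prod.distrib power_mult)
    finally have 1: "(\<Prod>i<r. A * p ^ t + p ^ (2 * t + i + 1)) = p ^ (t * r) * (\<Prod>i<r. A + p ^ (t + i + 1))" .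
    have 2: "int (t + r) - int t = int r" "int (t + r) + int t = int (2 * t + r)" "N - (t + r) = n - r"
      using n by auto
    show "?f (t + r) = ?c * (inv_qpoch p (int (n - r)) * inv_qpoch p (int r) *
      (\<Prod>i<r. A * p ^ t + p ^ (2 * t + i + 1)) * p ^ (r choose 2) * inv_qpoch p (int (2 * t + r)))"
      unfolding 1 2 choose_two_add prod_lessThan_add unfolding power_add by (simp only: ac_simps)
  qed simp
  also have "\<dots> = ?c * ((\<Prod>i<n. 1 + A * p ^ t * p ^ i) * inv_qpoch p (int n) * inv_qpoch p (int (n + 2 * t)))"
    unfolding sum_distrib_left[symmetric] q_chu_vandermonde[OF p0] ..
  also have "(\<Prod>i<n. 1 + A * p ^ t * p ^ i) = (\<Prod>i=t..<N. 1 + A * p ^ i)"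
    by (rule prod.reindex_bij_witness[of _ "\<lambda>s. s - t" "\<lambda>r. t + r"]) (auto simp: n power_add mult.assoc)
  finally show ?thesis using n by (simp add: mult.assoc algebra_simps)
qed

text \<open>
  Bailey's lemma relative to 1: summing the kernel against an arbitrary sequence turns one finite identity
  in s into another one in N, whose t-th term has acquired the factor found in \<open>bailey_kernel\<close>.  The
  kernel is even in t, whence the absolute values.
\<close>

lemma bailey_lemma:
  fixes a :: "int \<Rightarrow> rat fps"
  assumes p0: "fps_nth p 0 = 0"
  shows "(\<Sum>s\<le>N. (\<Prod>i<s. A + p ^ (i + 1)) * p ^ (s choose 2) * inv_qpoch p (int (N - s)) *
        (\<Sum>t = - int s..int s. a t * inv_qpoch p (int s - t) * inv_qpoch p (int s + t)))
    = (\<Sum>t = - int N..int N. a t * (\<Prod>i<nat \<bar>t\<bar>. A + p ^ (i + 1)) * p ^ (nat \<bar>t\<bar> choose 2) *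
        (\<Prod>i=nat \<bar>t\<bar>..<N. 1 + A * p ^ i) * inv_qpoch p (int N - t) * inv_qpoch p (int N + t))"
    (is "?L = ?R")
proof -
  let ?c = "\<lambda>s. (\<Prod>i<s. A + p ^ (i + 1)) * p ^ (s choose 2) * inv_qpoch p (int (N - s))"
  have sym: "inv_qpoch p (int s - t) * inv_qpoch p (int s + t)
      = inv_qpoch p (int s - int (nat \<bar>t\<bar>)) * inv_qpoch p (int s + int (nat \<bar>t\<bar>))" for s t
    by (cases "t \<ge> 0") auto
  have "?L = (\<Sum>s\<le>N. \<Sum>t = - int N..int N. ?c s * (a t * inv_qpoch p (int s - t) * inv_qpoch p (int s + t)))"
    unfolding sum_distrib_left
    by (intro sum.cong sum.mono_neutral_left) (auto simp: inv_qpoch_neg)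
  also have "\<dots> = (\<Sum>t = - int N..int N. \<Sum>s\<le>N. ?c s * (a t * inv_qpoch p (int s - t) * inv_qpoch p (int s + t)))"
    by (rule sum.swap)
  also have "\<dots> = (\<Sum>t = - int N..int N. a t * (\<Sum>s\<le>N. ?c s * (inv_qpoch p (int s - t) * inv_qpoch p (int s + t))))"
    by (simp only: sum_distrib_left ac_simps)
  also have "\<dots> = ?R"
  proof (rule sum.cong)
    fix t
    show "a t * (\<Sum>s\<le>N. ?c s * (inv_qpoch p (int s - t) * inv_qpoch p (int s + t)))
      = a t * (\<Prod>i<nat \<bar>t\<bar>. A + p ^ (i + 1)) * p ^ (nat \<bar>t\<bar> choose 2) *
        (\<Prod>i=nat \<bar>t\<bar>..<N. 1 + A * p ^ i) * inv_qpoch p (int N - t) * inv_qpoch p (int N + t)"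
      using bailey_kernel[OF p0, of A N "nat \<bar>t\<bar>"] unfolding sym[of _ t, symmetric] by (simp only: mult.assoc)
  qed simp
  finally show ?thesis .
qed

text \<open>
  The weights of \<open>bailey_lemma\<close> for A = 0.
\<close>

lemma prod_shifted_power: "(\<Prod>i<s. 0 + p ^ (i + 1)) * p ^ (s choose 2) = (p :: rat fps) ^ s\<^sup>2"
  by (induction s) (simp_all add: numeral_2_eq_2 power_add algebra_simps)

text \<open>
  The weights of \<open>bailey_lemma\<close> for A = q and p = q^2.  For this choice the two products
  over i < t and t \<le> i < N in the lemma merge into one that does not depend on t.
\<close>

lemma prod_odd_shift:
  "(\<Prod>i<s. q + (q\<^sup>2) ^ (i + 1)) * (q\<^sup>2) ^ (s choose 2) = (q :: rat fps) ^ s\<^sup>2 * qpoch (- q) (q\<^sup>2) s"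
  by (induction s) (simp_all add: qpoch_Suc numeral_2_eq_2 power_add algebra_simps power_mult_distrib)

lemma square_eq_triangle: "(t :: int)\<^sup>2 = 2 * (t * (t - 1) div 2) + t"
proof -
  have "even (t * (t - 1))" by simp
  then have "2 * (t * (t - 1) div 2) = t * (t - 1)" by simp
  then show ?thesis by (simp add: power2_eq_square algebra_simps)
qed

lemma nat_abs_power2: "int ((nat \<bar>t\<bar>)\<^sup>2) = t\<^sup>2"
  by simp

text \<open>
  The two steps of the chain multiply the t-th term by q^(2t^2) and q^(t^2); together they
  lead from the exponent t(t-1) to 4t^2 - t.
\<close>

lemma theta_term_multiplier: "theta_term q 0 2 t * (q ^ 2) ^ (nat \<bar>t\<bar>)\<^sup>2 * q ^ (nat \<bar>t\<bar>)\<^sup>2 = theta_term q 3 5 t"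
proof -
  have "int (nat (2 * (t * (t - 1) div 2)) + 2 * (nat \<bar>t\<bar>)\<^sup>2 + (nat \<bar>t\<bar>)\<^sup>2) = int (nat (8 * (t * (t - 1) div 2) + 3 * t))"
    using theta_term_exponent_nonneg[of 3 5 t] triangle_nonneg[of t] square_eq_triangle[of t]
    by (simp add: nat_abs_power2 del: of_nat_power)
  then have e: "nat (2 * (t * (t - 1) div 2)) + 2 * (nat \<bar>t\<bar>)\<^sup>2 + (nat \<bar>t\<bar>)\<^sup>2 = nat (8 * (t * (t - 1) div 2) + 3 * t)"
    by (simp only: of_nat_eq_iff)
  have "theta_term q 0 2 t * (q ^ 2) ^ (nat \<bar>t\<bar>)\<^sup>2 * q ^ (nat \<bar>t\<bar>)\<^sup>2
    = (-1) ^ nat \<bar>t\<bar> * q ^ (nat (2 * (t * (t - 1) div 2)) + 2 * (nat \<bar>t\<bar>)\<^sup>2 + (nat \<bar>t\<bar>)\<^sup>2)"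
    unfolding theta_term_def power_add power_mult by (simp add: mult.assoc)
  then show ?thesis unfolding e by (simp add: theta_term_def)
qed

text \<open>
  First step of the chain, A = 0.  The seed is the triple product with \<alpha> = 0: its right-hand side contains
  the factor (1; p)_s, which vanishes for s > 0, so that only s = 0 survives.  The name refers to the
  limit of large N, which is Euler's pentagonal number theorem.
\<close>

lemma finite_pentagonal:
  fixes q :: "rat fps"
  assumes q0: "fps_nth q 0 = 0"
  shows "(\<Sum>t = - int N..int N. theta_term q 0 2 t * (q ^ 2) ^ (nat \<bar>t\<bar>)\<^sup>2 * inv_qpoch (q ^ 2) (int N - t) * inv_qpoch (q ^ 2) (int N + t))
    = inv_qpoch (q ^ 2) (int N)"
proof -
  let ?p = "q ^ 2"
  have p0: "fps_nth ?p 0 = 0" using q0 by (simp add: fps_power_zeroth)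
  have unit: "(\<Sum>t = - int s..int s. theta_term q 0 2 t * inv_qpoch ?p (int s - t) * inv_qpoch ?p (int s + t)) = (if s = 0 then 1 else 0)" for s
  proof -
    have "qpoch (1::rat fps) ?p s = 0" if "s > 0"
      unfolding qpoch_def using that by (intro prod_zero bexI[of _ 0]) auto
    then show ?thesis
      using finite_triple_product[OF q0, of 0 2 s s, unfolded add_0 power_0] by (cases "s = 0") simp_all
  qed
  have "(\<Sum>t = - int N..int N. theta_term q 0 2 t * ?p ^ (nat \<bar>t\<bar>)\<^sup>2 * inv_qpoch ?p (int N - t) * inv_qpoch ?p (int N + t))
     = (\<Sum>t = - int N..int N. theta_term q 0 2 t * (\<Prod>i<nat \<bar>t\<bar>. 0 + ?p ^ (i + 1)) * ?p ^ (nat \<bar>t\<bar> choose 2) *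
        (\<Prod>i=nat \<bar>t\<bar>..<N. 1 + 0 * ?p ^ i) * inv_qpoch ?p (int N - t) * inv_qpoch ?p (int N + t))"
    unfolding prod_shifted_power[symmetric] by (simp only: ac_simps mult_zero_left mult_zero_right add_0_right prod.neutral_const mult_1_right mult_1_left)
  also have "\<dots> = (\<Sum>s\<le>N. if s = 0 then inv_qpoch ?p (int N) else 0)"
    unfolding bailey_lemma[OF p0, symmetric] unit by (intro sum.cong) (auto simp: numeral_2_eq_2)
  also have "\<dots> = inv_qpoch ?p (int N)" by simp
  finally show ?thesis .
qed

text \<open>
  Second step of the chain, A = q.  Its weights q^(s^2) (-q; q^2)_s, together with the reciprocal
  produced by the first step, are the summands in the generating function of gap partitions.
\<close>

lemma finite_goellnitz_gordon:
  fixes q :: "rat fps"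
  assumes q0: "fps_nth q 0 = 0"
  shows "(\<Sum>s\<le>N. q ^ s\<^sup>2 * qpoch (- q) (q\<^sup>2) s * inv_qpoch (q\<^sup>2) (int s) * inv_qpoch (q\<^sup>2) (int (N - s)))
    = qpoch (- q) (q\<^sup>2) N * (\<Sum>t = - int N..int N. theta_term q 3 5 t * inv_qpoch (q\<^sup>2) (int N - t) * inv_qpoch (q\<^sup>2) (int N + t))"
proof -
  let ?p = "q ^ 2"
  let ?a = "\<lambda>t. theta_term q 0 2 t * ?p ^ (nat \<bar>t\<bar>)\<^sup>2"
  have p0: "fps_nth ?p 0 = 0" using q0 by (simp add: fps_power_zeroth)
  have "(\<Sum>s\<le>N. q ^ s\<^sup>2 * qpoch (- q) ?p s * inv_qpoch ?p (int s) * inv_qpoch ?p (int (N - s)))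
    = (\<Sum>s\<le>N. (\<Prod>i<s. q + ?p ^ (i + 1)) * ?p ^ (s choose 2) * inv_qpoch ?p (int (N - s)) *
        (\<Sum>t = - int s..int s. ?a t * inv_qpoch ?p (int s - t) * inv_qpoch ?p (int s + t)))"
    unfolding finite_pentagonal[OF q0] prod_odd_shift by (simp only: ac_simps)
  also have "\<dots> = (\<Sum>t = - int N..int N. qpoch (- q) ?p N * (theta_term q 3 5 t * inv_qpoch ?p (int N - t) * inv_qpoch ?p (int N + t)))"
    unfolding bailey_lemma[OF p0]
  proof (rule sum.cong)
    fix t assume "t \<in> {- int N..int N}"
    then obtain n where n: "N = nat \<bar>t\<bar> + n" using le_Suc_ex[of "nat \<bar>t\<bar>" N] by (metis abs_le_iff atLeastAtMost_iff minus_le_iff nat_le_iff)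
    have "qpoch (- q) ?p N = qpoch (- q) ?p (nat \<bar>t\<bar>) * (\<Prod>i=nat \<bar>t\<bar>..<N. 1 + q * ?p ^ i)"
      unfolding qpoch_def by (simp add: lessThan_atLeast0 prod.atLeastLessThan_concat n)
    then have "?a t * (\<Prod>i<nat \<bar>t\<bar>. q + ?p ^ (i + 1)) * ?p ^ (nat \<bar>t\<bar> choose 2) * (\<Prod>i=nat \<bar>t\<bar>..<N. 1 + q * ?p ^ i)
      = qpoch (- q) ?p N * (?a t * q ^ (nat \<bar>t\<bar>)\<^sup>2)"
      using prod_odd_shift[of q "nat \<bar>t\<bar>"] by (simp only: mult.assoc) (simp only: ac_simps)
    then show "?a t * (\<Prod>i<nat \<bar>t\<bar>. q + ?p ^ (i + 1)) * ?p ^ (nat \<bar>t\<bar> choose 2) * (\<Prod>i=nat \<bar>t\<bar>..<N. 1 + q * ?p ^ i)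
       * inv_qpoch ?p (int N - t) * inv_qpoch ?p (int N + t)
      = qpoch (- q) ?p N * (theta_term q 3 5 t * inv_qpoch ?p (int N - t) * inv_qpoch ?p (int N + t))"
      unfolding theta_term_multiplier by (simp only: mult.assoc)
  qed simp
  finally show ?thesis unfolding sum_distrib_left .
qed

section \<open>Congruence of power series modulo powers of the variable\<close>

definition xcong :: "nat \<Rightarrow> rat fps \<Rightarrow> rat fps \<Rightarrow> bool" where
  "xcong K f g \<longleftrightarrow> fps_X ^ K dvd f - g"

lemma xcong_refl [simp, intro]: "xcong K f f"
  by (simp add: xcong_def)

lemma xcong_sym: "xcong K f g \<Longrightarrow> xcong K g f"
  unfolding xcong_def by (subst dvd_diff_commute)

lemma xcong_trans [trans]: "xcong K f g \<Longrightarrow> xcong K g h \<Longrightarrow> xcong K f h"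
  unfolding xcong_def using dvd_add[of "fps_X ^ K" "f - g" "g - h"] by simp

lemma xcong_mult: "xcong K f g \<Longrightarrow> xcong K f' g' \<Longrightarrow> xcong K (f * f') (g * g')"
proof -
  assume "xcong K f g" "xcong K f' g'"
  moreover have "f * f' - g * g' = (f - g) * f' + g * (f' - g')" by (simp add: algebra_simps)
  ultimately show ?thesis unfolding xcong_def by (auto intro: dvd_add dvd_mult dvd_mult2)
qed

lemma xcong_sum: "(\<And>i. i \<in> A \<Longrightarrow> xcong K (f i) (g i)) \<Longrightarrow> xcong K (sum f A) (sum g A)"
  unfolding xcong_def sum_subtractf[symmetric] by (rule dvd_sum)

text \<open>
  A power of X in front of both sides improves the precision.  In the sums
  below this compensates for the indices near the boundary, where the other factors have not yet
  stabilised.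
\<close>

lemma xcong_fps_X_power_mult:
  assumes "xcong e f g" "K \<le> d + e"
  shows "xcong K (fps_X ^ d * f) (fps_X ^ d * g)"
proof -
  have "fps_X ^ (d + e) dvd fps_X ^ d * (f - g)"
    using assms(1) unfolding xcong_def power_add by (rule mult_dvd_mono[OF dvd_refl])
  then show ?thesis
    unfolding xcong_def using assms(2) power_le_dvd by (metis right_diff_distrib)
qed

lemma xcong_inverse:
  assumes "xcong K f g" "fps_nth f 0 = 1" "fps_nth g 0 = 1"
  shows "xcong K (inverse f) (inverse g)"
proof -
  have "inverse f * f = 1" "inverse g * g = 1"
    using assms by (simp_all add: inverse_mult_eq_1)
  then have "inverse f - inverse g = - (inverse f * inverse g) * (f - g)"
    by (simp add: algebra_simps)
  then show ?thesis using assms(1) unfolding xcong_def by simp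
qed

text \<open>
  Congruence modulo X^K amounts to agreement of the coefficients below K; this direction turns the congruences
  back into statements about numbers of partitions.
\<close>

lemma xcong_nth: "xcong K f g \<Longrightarrow> n < K \<Longrightarrow> fps_nth f n = fps_nth g n"
  unfolding xcong_def by (elim dvdE) (metis eq_iff_diff_eq_0 fps_X_power_mult_nth fps_sub_nth)

lemma xcong_qpoch:
  assumes "N \<le> L" "K \<le> a + c * N"
  shows "xcong K (qpoch (u * fps_X ^ a) (fps_X ^ c) L) (qpoch (u * fps_X ^ a) (fps_X ^ c) N)"
  using assms(1)
proof (induction L rule: dec_induct)
  case (step L)
  have "K \<le> a + c * L" using step.hyps assms(2) by (meson add_le_mono le_refl le_trans mult_le_mono2)
  then have "fps_X ^ K dvd u * fps_X ^ (a + c * L)"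
    by (intro dvd_mult le_imp_power_dvd)
  then have "xcong K (1 - u * fps_X ^ a * (fps_X ^ c) ^ L) 1"
    unfolding xcong_def by (simp add: power_add power_mult mult.assoc)
  from xcong_mult[OF step.IH this] show ?case by (simp add: qpoch_Suc)
qed simp

lemma xcong_inv_qpoch_le:
  assumes "c > 0" "N \<le> L" "K \<le> c * (N + 1)"
  shows "xcong K (inv_qpoch (fps_X ^ c) (int L)) (inv_qpoch (fps_X ^ c) (int N))"
  unfolding inv_qpoch_def
  using xcong_qpoch[of N L K c c 1] assms
  by (auto intro!: xcong_inverse qpoch_nth_0)

lemma xcong_inv_qpoch:
  assumes "c > 0" "a \<ge> 0" "b \<ge> 0" "int K \<le> int c * (a + 1)" "int K \<le> int c * (b + 1)"
  shows "xcong K (inv_qpoch (fps_X ^ c) a) (inv_qpoch (fps_X ^ c) b)"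
proof -
  obtain A B where [simp]: "a = int A" "b = int B"
    using assms(2,3) nonneg_int_cases by metis
  have "int K \<le> int (c * (A + 1))" "int K \<le> int (c * (B + 1))"
    using assms(4,5) by (simp_all add: algebra_simps)
  then have "K \<le> c * (A + 1)" "K \<le> c * (B + 1)" by (simp_all only: of_nat_le_iff)
  then show ?thesis
    using xcong_inv_qpoch_le[OF assms(1), of A B K] xcong_inv_qpoch_le[OF assms(1), of B A K]
    by (cases "A \<le> B") (auto intro: xcong_sym)
qed

section \<open>The generating function as a product\<close>

definition theta :: "nat \<Rightarrow> rat fps" where
  "theta N = (\<Sum>t = - int N..int N. theta_term fps_X 3 5 t)"

text \<open>
  In the term with index t the two reciprocals agree with 1 / (p; p)_N up to order at least
  N - |t| + 1, while the theta term itself has order 4t^2 - t; these orders add up to at least N.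
\<close>

lemma xcong_theta:
  assumes c: "c > 0"
  defines "p \<equiv> fps_X ^ c"
  shows "xcong N (\<Sum>t = - int N..int N. theta_term fps_X 3 5 t * inv_qpoch p (int N - t) * inv_qpoch p (int N + t))
     (theta N * (inv_qpoch p (int N) * inv_qpoch p (int N)))"
  unfolding theta_def sum_distrib_right
proof (rule xcong_sum)
  fix t assume t: "t \<in> {- int N..int N}"
  define e where "e = nat (8 * (t * (t - 1) div 2) + 3 * t)"
  (* the order of agreement in the least favourable case c = 1 *)
  define K where "K = nat (int N - \<bar>t\<bar> + 1)"
  have K: "int K = int N - \<bar>t\<bar> + 1" using t by (auto simp: K_def)
  have Kc: "int K \<le> int c * (x + 1)" if "x \<ge> int N - \<bar>t\<bar>" for x
    using mult_mono[of 1 "int c" "int K" "x + 1"] that c K by simp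
  have "xcong K (inv_qpoch p (int N - t) * inv_qpoch p (int N + t)) (inv_qpoch p (int N) * inv_qpoch p (int N))"
    unfolding p_def using c t Kc by (intro xcong_mult xcong_inv_qpoch) auto
  moreover have "N \<le> e + K"
  proof -
    have "4 * \<bar>t\<bar> \<le> 4 * t\<^sup>2"
      using self_le_power[of "\<bar>t\<bar>" 2] by (cases "t = 0") auto
    moreover have "int e = 4 * t\<^sup>2 - t"
      using theta_term_exponent_nonneg[of 3 5 t] square_eq_triangle[of t] by (simp add: e_def)
    ultimately have "int N \<le> int e + int K" unfolding K using t by auto
    then show ?thesis by simp
  qed
  ultimately have "xcong N (fps_X ^ e * (inv_qpoch p (int N - t) * inv_qpoch p (int N + t))) (fps_X ^ e * (inv_qpoch p (int N) * inv_qpoch p (int N)))"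
    by (rule xcong_fps_X_power_mult)
  then have "xcong N ((-1) ^ nat \<bar>t\<bar> * (fps_X ^ e * (inv_qpoch p (int N - t) * inv_qpoch p (int N + t))))
    ((-1) ^ nat \<bar>t\<bar> * (fps_X ^ e * (inv_qpoch p (int N) * inv_qpoch p (int N))))"
    by (rule xcong_mult[OF xcong_refl])
  then show "xcong N (theta_term fps_X 3 5 t * inv_qpoch p (int N - t) * inv_qpoch p (int N + t)) (theta_term fps_X 3 5 t * (inv_qpoch p (int N) * inv_qpoch p (int N)))"
    by (simp add: theta_term_def e_def mult.assoc)
qed

lemma qpoch_double: "qpoch a p (2 * n) = qpoch a (p\<^sup>2) n * qpoch (a * p) (p\<^sup>2) n"
proof (induction n)
  case (Suc n)
  have "qpoch a p (2 * Suc n) = qpoch a p (2 * n) * (1 - a * p ^ (2 * n)) * (1 - a * (p * p ^ (2 * n)))"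
    by (simp add: qpoch_Suc)
  also have "p ^ (2 * n) = (p\<^sup>2) ^ n" by (rule power_mult)
  finally show ?case unfolding Suc.IH by (simp only: qpoch_Suc mult_1_right ac_simps)
qed simp

lemma qpoch_mult_minus: "qpoch a p n * qpoch (- a) p n = qpoch (a\<^sup>2) (p\<^sup>2) n"
proof (induction n)
  case (Suc n)
  have "qpoch a p (Suc n) * qpoch (- a) p (Suc n) = (qpoch a p n * qpoch (- a) p n) * ((1 - a * p ^ n) * (1 + a * p ^ n))"
    by (simp add: qpoch_Suc ac_simps)
  also have "(1 - a * p ^ n) * (1 + a * p ^ n) = 1 - a\<^sup>2 * (p\<^sup>2) ^ n"
    by (simp add: algebra_simps power2_eq_square power_mult_distrib)
  finally show ?case by (simp add: Suc.IH qpoch_Suc)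
qed simp

text \<open>
  The generating function of the gap partitions with at most N parts, all of them larger than 2m, as
  \<open>gg_sum_nth\<close> will show.  The s-th summand accounts for the partitions with exactly s parts.
\<close>

definition gg_sum :: "nat \<Rightarrow> nat \<Rightarrow> rat fps" where
  "gg_sum N m = (\<Sum>s\<le>N. fps_X ^ (s\<^sup>2 + 2 * m * s) * qpoch (- fps_X) (fps_X\<^sup>2) s * inv_qpoch (fps_X\<^sup>2) (int s))"

text \<open>
  The reciprocal of the generating function of partitions into parts below 8N that are 1, 4 or 7
  modulo 8.
\<close>

definition residue_product :: "nat \<Rightarrow> rat fps" where
  "residue_product N = qpoch fps_X (fps_X ^ 8) N * qpoch (fps_X ^ 4) (fps_X ^ 8) N * qpoch (fps_X ^ 7) (fps_X ^ 8) N"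

text \<open>
  Jacobi's triple product modulo X^N.
\<close>

lemma theta_product:
  "xcong N (theta N) (qpoch (fps_X ^ 3) (fps_X ^ 8) N * qpoch (fps_X ^ 5) (fps_X ^ 8) N * qpoch (fps_X ^ 8) (fps_X ^ 8) N)"
proof -
  let ?p = "fps_X ^ 8 :: rat fps"
  let ?B = "qpoch (fps_X ^ 3) ?p N * qpoch (fps_X ^ 5) ?p N"
  let ?D = "qpoch ?p ?p N" and ?E = "inv_qpoch ?p (int N)"
  have DE: "?D * ?E = 1" by (rule qpoch_inv_qpoch) simp
  have "xcong N (theta N * (?E * ?E)) (?B * inv_qpoch ?p (int (N + N)))"
    using xcong_sym[OF xcong_theta[of 8 N]] finite_triple_product[of fps_X 3 5 N N] by simp
  also have "xcong N (?B * inv_qpoch ?p (int (N + N))) (?B * ?E)"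
    by (intro xcong_mult xcong_refl xcong_inv_qpoch_le) auto
  finally have "xcong N (theta N * (?E * ?E) * (?D * ?D)) (?B * ?E * (?D * ?D))"
    by (rule xcong_mult) simp
  moreover have "theta N * (?E * ?E) * (?D * ?D) = theta N * (?D * ?E) * (?D * ?E)" by (simp only: ac_simps)
  moreover have "?B * ?E * (?D * ?D) = ?B * ?D * (?D * ?E)" by (simp only: ac_simps)
  ultimately show ?thesis unfolding DE by simp
qed

text \<open>
  The limit of \<open>finite_goellnitz_gordon\<close>: the reciprocals at N - s, N - t and N + t stabilise, and one factor 1 / (q^2; q^2)_N cancels.
\<close>

lemma gg_sum_theta:
  "xcong N (gg_sum N 0) (qpoch (- fps_X) (fps_X\<^sup>2) N * theta N * inv_qpoch (fps_X\<^sup>2) (int N))"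
proof -
  let ?p = "fps_X\<^sup>2 :: rat fps"
  let ?E = "\<lambda>n. inv_qpoch ?p (int n)" and ?pm = "qpoch (- fps_X) ?p"
  have CE: "qpoch ?p ?p N * ?E N = 1" by (rule qpoch_inv_qpoch) simp
  have "xcong N (\<Sum>s\<le>N. fps_X ^ s\<^sup>2 * (?pm s * ?E s * ?E (N - s))) (\<Sum>s\<le>N. fps_X ^ s\<^sup>2 * (?pm s * ?E s * ?E N))"
  proof (intro xcong_sum xcong_fps_X_power_mult xcong_mult xcong_refl)
    fix s assume s: "s \<in> {..N}"
    show "xcong (2 * (N - s + 1)) (?E (N - s)) (?E N)"
      by (rule xcong_sym, rule xcong_inv_qpoch_le) auto
    have "s \<le> s\<^sup>2" by (simp add: power2_nat_le_imp_le self_le_power)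
    then show "N \<le> s\<^sup>2 + 2 * (N - s + 1)" using s by auto
  qed
  also have "(\<Sum>s\<le>N. fps_X ^ s\<^sup>2 * (?pm s * ?E s * ?E (N - s))) =
    ?pm N * (\<Sum>t = - int N..int N. theta_term fps_X 3 5 t * inv_qpoch ?p (int N - t) * inv_qpoch ?p (int N + t))"
    using finite_goellnitz_gordon[of fps_X N] by (simp add: mult.assoc)
  also have "(\<Sum>s\<le>N. fps_X ^ s\<^sup>2 * (?pm s * ?E s * ?E N)) = gg_sum N 0 * ?E N"
    unfolding gg_sum_def sum_distrib_right by (simp add: mult.assoc)
  finally have "xcong N (gg_sum N 0 * ?E N) (?pm N * (\<Sum>t = - int N..int N. theta_term fps_X 3 5 t * inv_qpoch ?p (int N - t) * inv_qpoch ?p (int N + t)))"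
    by (rule xcong_sym)
  also have "xcong N \<dots> (?pm N * (theta N * (?E N * ?E N)))"
    by (intro xcong_mult xcong_refl xcong_theta) simp
  finally have "xcong N (gg_sum N 0 * ?E N * qpoch ?p ?p N) (?pm N * (theta N * (?E N * ?E N)) * qpoch ?p ?p N)"
    by (rule xcong_mult) simp
  moreover have "gg_sum N 0 * ?E N * qpoch ?p ?p N = gg_sum N 0 * (qpoch ?p ?p N * ?E N)" by (simp only: ac_simps)
  moreover have "?pm N * (theta N * (?E N * ?E N)) * qpoch ?p ?p N = ?pm N * theta N * ?E N * (qpoch ?p ?p N * ?E N)"
    by (simp only: ac_simps)
  ultimately show ?thesis unfolding CE by simp
qed

text \<open>
  The odd numbers below 8N, sorted by their residue modulo 8.
\<close>

lemma residue_classes_product: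
  fixes q :: "'a :: comm_ring_1"
  shows "qpoch q (q\<^sup>2) (4 * N) = qpoch q (q ^ 8) N * qpoch (q ^ 3) (q ^ 8) N * qpoch (q ^ 5) (q ^ 8) N * qpoch (q ^ 7) (q ^ 8) N"
proof -
  have "4 * N = 2 * (2 * N)" by simp
  then have "qpoch q (q\<^sup>2) (4 * N) = qpoch q (((q\<^sup>2)\<^sup>2)\<^sup>2) N * qpoch (q * (q\<^sup>2)\<^sup>2) (((q\<^sup>2)\<^sup>2)\<^sup>2) N *
    (qpoch (q * q\<^sup>2) (((q\<^sup>2)\<^sup>2)\<^sup>2) N * qpoch (q * q\<^sup>2 * (q\<^sup>2)\<^sup>2) (((q\<^sup>2)\<^sup>2)\<^sup>2) N)"
    by (simp only: qpoch_double)
  moreover have "((q\<^sup>2)\<^sup>2)\<^sup>2 = q ^ 8" "q * (q\<^sup>2)\<^sup>2 = q ^ 5" "q * q\<^sup>2 = q ^ 3" "q * q\<^sup>2 * (q\<^sup>2)\<^sup>2 = q ^ 7"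
    by (simp_all add: eval_nat_numeral ac_simps)
  ultimately show ?thesis by (simp only: ac_simps)
qed

text \<open>
  By \<open>gg_sum_theta\<close> and \<open>theta_product\<close> the claim is that
  (q, q^3, q^4, q^5, q^7, q^8; q^8) (-q; q^2) agrees with (q^2; q^2) up to order N, where each product has at
  least N factors and a comma separates the leading terms of several products with the same base.  Here the four odd classes form
  (q; q^2), which together with (-q; q^2) gives (q^2; q^4), and the two remaining classes form
  (q^4; q^4).
\<close>

lemma gg_product:
  "xcong N (gg_sum N 0 * residue_product N) 1"
proof -
  let ?X = "fps_X :: rat fps"
  let ?pm = "qpoch (- ?X) (?X\<^sup>2)" and ?p8 = "?X ^ 8"
  let ?C = "qpoch (?X\<^sup>2) (?X\<^sup>2)"
  let ?B = "qpoch (?X ^ 3) ?p8 N * qpoch (?X ^ 5) ?p8 N * qpoch ?p8 ?p8 N"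
  have CE: "?C N * inv_qpoch (?X\<^sup>2) (int N) = 1" by (rule qpoch_inv_qpoch) simp
  have "?C (4 * N) = qpoch (?X\<^sup>2) ((?X\<^sup>2)\<^sup>2) (2 * N) * qpoch (?X\<^sup>2 * ?X\<^sup>2) ((?X\<^sup>2)\<^sup>2) (2 * N)"
    using qpoch_double[of "?X\<^sup>2" "?X\<^sup>2" "2 * N"] by simp
  also have "qpoch (?X\<^sup>2) ((?X\<^sup>2)\<^sup>2) (2 * N) = qpoch ?X (?X\<^sup>2) (2 * N) * ?pm (2 * N)"
    by (rule qpoch_mult_minus[symmetric])
  also have "qpoch (?X\<^sup>2 * ?X\<^sup>2) ((?X\<^sup>2)\<^sup>2) (2 * N) = qpoch (?X ^ 4) ?p8 N * qpoch ?p8 ?p8 N"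
    unfolding qpoch_double by (simp flip: power_add power_mult)
  finally have C: "?C (4 * N) = qpoch ?X (?X\<^sup>2) (2 * N) * ?pm (2 * N) * (qpoch (?X ^ 4) ?p8 N * qpoch ?p8 ?p8 N)" .
  have "xcong N (residue_product N * (?pm N * ?B)) (qpoch ?X (?X\<^sup>2) (4 * N) * ?pm N * (qpoch (?X ^ 4) ?p8 N * qpoch ?p8 ?p8 N))"
    unfolding residue_classes_product residue_product_def by (simp add: ac_simps)
  also have "xcong N \<dots> (?C (4 * N))"
    unfolding C
  proof (intro xcong_mult xcong_refl)
    show "xcong N (qpoch ?X (?X\<^sup>2) (4 * N)) (qpoch ?X (?X\<^sup>2) (2 * N))"
      using xcong_qpoch[of "2 * N" "4 * N" N 1 2 1] by simp
    show "xcong N (?pm N) (?pm (2 * N))"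
      using xcong_sym[OF xcong_qpoch[of N "2 * N" N 1 2 "-1"]] by simp
  qed
  also have "xcong N (?C (4 * N)) (?C N)"
    using xcong_qpoch[of N "4 * N" N 2 2 1] by simp
  finally have 1: "xcong N (residue_product N * (?pm N * ?B)) (?C N)" .
  have "xcong N (gg_sum N 0) (?pm N * ?B * inv_qpoch (?X\<^sup>2) (int N))"
    using gg_sum_theta by (rule xcong_trans) (intro xcong_mult xcong_refl theta_product)
  then have "xcong N (gg_sum N 0 * residue_product N) (?pm N * ?B * inv_qpoch (?X\<^sup>2) (int N) * residue_product N)"
    by (rule xcong_mult) simp
  also have "\<dots> = residue_product N * (?pm N * ?B) * inv_qpoch (?X\<^sup>2) (int N)" by (simp only: ac_simps)
  also have "xcong N \<dots> (?C N * inv_qpoch (?X\<^sup>2) (int N))"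
    by (intro xcong_mult xcong_refl 1)
  finally show ?thesis unfolding CE .
qed

text \<open>
  In the difference of the sums for m and m + 1 each summand gains the factor 1 - q^(2s), which cancels
  against the last factor of (q^2; q^2)_s.  Shifting s and splitting 1 + q^(2s+1) leaves the two other sums.
\<close>

lemma gg_sum_rec:
  "gg_sum (Suc N) m = gg_sum (Suc N) (Suc m) + fps_X ^ (2 * m + 1) * gg_sum N (Suc m) + fps_X ^ (2 * m + 2) * gg_sum N (Suc (Suc m))"
proof -
  let ?X = "fps_X :: rat fps"
  let ?E = "\<lambda>s. inv_qpoch (?X\<^sup>2) (int s)" and ?pm = "qpoch (- ?X) (?X\<^sup>2)"
  let ?f = "\<lambda>m s. ?X ^ (s\<^sup>2 + 2 * m * s) * ?pm s * ?E s"
  have step: "?f m (Suc r) - ?f (Suc m) (Suc r) = ?X ^ (2 * m + 1) * ?f (Suc m) r + ?X ^ (2 * m + 2) * ?f (Suc (Suc m)) r" for r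
  proof -
    have E: "?E r = (1 - ?X ^ (2 * Suc r)) * ?E (Suc r)"
      unfolding power_mult by (rule inv_qpoch_Suc) simp
    have pm: "?pm (Suc r) = ?pm r * (1 + ?X ^ (2 * r + 1))"
      by (simp add: qpoch_Suc power_mult)
    have e1: "(Suc r)\<^sup>2 + 2 * Suc m * Suc r = (Suc r)\<^sup>2 + 2 * m * Suc r + 2 * Suc r" by simp
    have e2: "(Suc r)\<^sup>2 + 2 * m * Suc r = (2 * m + 1) + (r\<^sup>2 + 2 * Suc m * r)"
      by (simp add: power2_eq_square algebra_simps)
    have e3: "(2 * m + 2) + (r\<^sup>2 + 2 * Suc (Suc m) * r) = (2 * m + 1) + (r\<^sup>2 + 2 * Suc m * r) + (2 * r + 1)"
      by (simp add: power2_eq_square algebra_simps)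
    have "?f m (Suc r) - ?f (Suc m) (Suc r) = ?X ^ ((Suc r)\<^sup>2 + 2 * m * Suc r) * ?pm (Suc r) * ((1 - ?X ^ (2 * Suc r)) * ?E (Suc r))"
      unfolding e1 power_add[of _ _ "2 * Suc r"] by (simp only: right_diff_distrib left_diff_distrib mult_1_left ac_simps)
    also have "\<dots> = ?X ^ (2 * m + 1) * ?f (Suc m) r + ?X ^ ((2 * m + 1) + (r\<^sup>2 + 2 * Suc m * r) + (2 * r + 1)) * ?pm r * ?E r"
      unfolding E[symmetric] pm e2 power_add[of _ "2 * m + 1" "r\<^sup>2 + 2 * Suc m * r"] power_add[of _ "2 * m + 1 + (r\<^sup>2 + 2 * Suc m * r)" "2 * r + 1"]
      by (simp only: ring_distribs mult_1_left mult_1_right ac_simps)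
    finally show ?thesis unfolding e3[symmetric] power_add[of _ "2 * m + 2"] by (simp only: mult.assoc)
  qed
  have "gg_sum (Suc N) m - gg_sum (Suc N) (Suc m) = (\<Sum>s\<le>Suc N. ?f m s - ?f (Suc m) s)"
    unfolding gg_sum_def by (rule sum_subtractf[symmetric])
  also have "\<dots> = (\<Sum>r\<le>N. ?f m (Suc r) - ?f (Suc m) (Suc r))"
    by (subst sum.atMost_Suc_shift) simp
  also have "\<dots> = ?X ^ (2 * m + 1) * gg_sum N (Suc m) + ?X ^ (2 * m + 2) * gg_sum N (Suc (Suc m))"
    unfolding step sum.distrib gg_sum_def sum_distrib_left ..
  finally show ?thesis by (simp add: algebra_simps)
qed

lemma gg_sum_nth_less:
  assumes "n < 2 * m + 1"
  shows "fps_nth (gg_sum N m) n = fps_nth 1 n"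
proof -
  have "fps_nth (fps_X ^ (s\<^sup>2 + 2 * m * s) * qpoch (- fps_X) (fps_X\<^sup>2) s * inv_qpoch (fps_X\<^sup>2) (int s)) n = (if s = 0 then fps_nth 1 n else 0)" for s
  proof (cases s)
    case (Suc r)
    (* every summand except s = 0 starts beyond X^n *)
    have "n < s\<^sup>2 + 2 * m * s" using assms unfolding Suc by (simp add: power2_eq_square)
    then show ?thesis using Suc by (simp only: mult.assoc fps_X_power_mult_nth) simp
  qed simp
  then show ?thesis unfolding gg_sum_def fps_sum_nth by simp
qed

section \<open>Gap partitions and their generating function\<close>

text \<open>
  The parts in increasing order, all at least m.  After an even part x the next one is at least x + 3,
  since x + 2 would be even as well.
\<close>

fun gap_from :: "nat \<Rightarrow> nat list \<Rightarrow> bool" where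
  "gap_from m [] = True"
| "gap_from m (x # xs) = (m \<le> x \<and> gap_from (if even x then x + 3 else x + 2) xs)"

definition gap_lists :: "nat \<Rightarrow> nat \<Rightarrow> nat \<Rightarrow> nat list set" where
  "gap_lists N m n = {xs. gap_from (2 * m + 1) xs \<and> length xs \<le> N \<and> sum_list xs = n}"

lemma finite_gap_lists: "finite (gap_lists N m n)"
proof (rule finite_subset)
  show "gap_lists N m n \<subseteq> {xs. set xs \<subseteq> {..n} \<and> length xs \<le> N}"
    using member_le_sum_list by (auto simp: gap_lists_def)
qed (simp add: finite_lists_length_le)

text \<open>
  The smallest part is 2m + 1, or 2m + 2, or at least 2m + 3.  This mirrors the three summands
  of \<open>gg_sum_rec\<close>.
\<close>

lemma gap_from_Cons_odd:
  "gap_from (2 * m + 1) (x # xs) \<longleftrightarrow>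
    x = 2 * m + 1 \<and> gap_from (2 * Suc m + 1) xs \<or>
    x = 2 * m + 2 \<and> gap_from (2 * Suc (Suc m) + 1) xs \<or>
    gap_from (2 * Suc m + 1) (x # xs)"
proof -
  have e: "2 * Suc m + 1 = 2 * m + 1 + 2" "2 * Suc (Suc m) + 1 = 2 * m + 2 + 3" by simp_all
  consider "x < 2 * m + 1" | "x = 2 * m + 1" | "x = 2 * m + 2" | "x \<ge> 2 * m + 3" by linarith
  then show ?thesis unfolding e by cases auto
qed

lemma gap_lists_rec:
  "gap_lists (Suc N) m n = gap_lists (Suc N) (Suc m) n
    \<union> (if n < 2 * m + 1 then {} else (#) (2 * m + 1) ` gap_lists N (Suc m) (n - (2 * m + 1)))
    \<union> (if n < 2 * m + 2 then {} else (#) (2 * m + 2) ` gap_lists N (Suc (Suc m)) (n - (2 * m + 2)))"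
    (is "?L = ?A \<union> ?B \<union> ?C")
proof (rule set_eqI)
  fix xs
  show "xs \<in> ?L \<longleftrightarrow> xs \<in> ?A \<union> ?B \<union> ?C"
  proof (cases xs)
    case (Cons y ys)
    have s: "sum_list ys = n - c \<longleftrightarrow> c + sum_list ys = n" if "\<not> n < c" for c
      using that by linarith
    have B: "y # ys \<in> ?B \<longleftrightarrow> y = 2 * m + 1 \<and> gap_from (2 * Suc m + 1) ys \<and> length ys \<le> N \<and> y + sum_list ys = n"
      by (auto simp: gap_lists_def s)
    have C: "y # ys \<in> ?C \<longleftrightarrow> y = 2 * m + 2 \<and> gap_from (2 * Suc (Suc m) + 1) ys \<and> length ys \<le> N \<and> y + sum_list ys = n"
      by (auto simp: gap_lists_def s)
    show ?thesis unfolding Cons Un_iff B C unfolding gap_lists_def mem_Collect_eq gap_from_Cons_odd[of m] by auto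
  qed (auto simp: gap_lists_def)
qed

lemma card_gap_lists_rec:
  "card (gap_lists (Suc N) m n) = card (gap_lists (Suc N) (Suc m) n)
    + (if n < 2 * m + 1 then 0 else card (gap_lists N (Suc m) (n - (2 * m + 1))))
    + (if n < 2 * m + 2 then 0 else card (gap_lists N (Suc (Suc m)) (n - (2 * m + 2))))"
proof -
  let ?A = "gap_lists (Suc N) (Suc m) n"
  let ?B = "if n < 2 * m + 1 then {} else (#) (2 * m + 1) ` gap_lists N (Suc m) (n - (2 * m + 1))"
  let ?C = "if n < 2 * m + 2 then {} else (#) (2 * m + 2) ` gap_lists N (Suc (Suc m)) (n - (2 * m + 2))"
  have "finite ?A" "finite ?B" "finite ?C" by (simp_all add: finite_gap_lists)
  moreover have "?A \<inter> ?B = {}" "(?A \<union> ?B) \<inter> ?C = {}"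
  proof -
    have A: "hd xs \<ge> 2 * m + 3" if "xs \<in> ?A" "xs \<noteq> []" for xs
      using that by (cases xs) (auto simp: gap_lists_def)
    have B: "xs \<noteq> [] \<and> hd xs = 2 * m + 1" if "xs \<in> ?B" for xs
      using that by (auto split: if_splits)
    have C: "xs \<noteq> [] \<and> hd xs = 2 * m + 2" if "xs \<in> ?C" for xs
      using that by (auto split: if_splits)
    have "False" if "xs \<in> ?A" "xs \<in> ?B" for xs
      using A[OF that(1)] B[OF that(2)] by linarith
    then show "?A \<inter> ?B = {}" by blast
    have "False" if "xs \<in> ?A \<union> ?B" "xs \<in> ?C" for xs
    proof -
      have "hd xs \<noteq> 2 * m + 2" using that(1) A[of xs] B[of xs] C[OF that(2)] by fastforce
      then show False using C[OF that(2)] by simp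
    qed
    then show "(?A \<union> ?B) \<inter> ?C = {}" by blast
  qed
  moreover have "card ?B = (if n < 2 * m + 1 then 0 else card (gap_lists N (Suc m) (n - (2 * m + 1))))"
    "card ?C = (if n < 2 * m + 2 then 0 else card (gap_lists N (Suc (Suc m)) (n - (2 * m + 2))))"
    by (simp_all add: card_image inj_on_def)
  ultimately show ?thesis
    unfolding gap_lists_rec[of N m n] by (simp only: card_Un_disjoint finite_Un simp_thms)
qed

lemma card_gap_lists_less:
  assumes "n < 2 * m + 1"
  shows "of_nat (card (gap_lists N m n)) = fps_nth (1 :: rat fps) n"
proof -
  have "xs = []" if "xs \<in> gap_lists N m n" for xs
    using that assms by (cases xs) (auto simp: gap_lists_def)
  moreover have "[] \<in> gap_lists N m n \<longleftrightarrow> n = 0"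
    by (auto simp: gap_lists_def)
  ultimately have "gap_lists N m n = (if n = 0 then {[]} else {})"
    by (cases "n = 0") auto
  then show ?thesis by simp
qed

text \<open>
  Both sides obey the same recurrence and agree below 2m + 1.  The recurrence lowers N or raises m,
  so for given n it ends after finitely many steps.
\<close>

lemma gg_sum_nth: "fps_nth (gg_sum N m) n = of_nat (card (gap_lists N m n))"
proof (induction N arbitrary: m n)
  case 0
  have "gap_lists 0 m n = (if n = 0 then {[]} else {})" by (auto simp: gap_lists_def)
  then show ?case by (simp add: gg_sum_def)
next
  case (Suc N)
  show ?case
  proof (induction "n - m" arbitrary: m rule: less_induct)
    case less
    show ?case
    proof (cases "n < 2 * m + 1")
      case True
      then show ?thesis by (simp only: gg_sum_nth_less card_gap_lists_less)
    next
      case False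
      then have "n - Suc m < n - m" by simp
      from less[OF this] show ?thesis
        unfolding gg_sum_rec[of N m] card_gap_lists_rec[of N m] fps_add_nth fps_X_power_mult_nth Suc.IH
        by simp
    qed
  qed
qed

text \<open>
  The condition on successive parts x > y in terms of the parity of y alone, which is the form
  in which the floors in the theorem refer to it.
\<close>

definition gap :: "nat \<Rightarrow> nat \<Rightarrow> bool" where
  "gap x y \<longleftrightarrow> y + (if even y then 3 else 2) \<le> x"

lemma gap_condition_iff: "gap_condition xs \<longleftrightarrow> successively gap xs"
proof -
  have gap: "gap x y \<longleftrightarrow> int x - int y \<ge> 2 \<and> (even x \<and> even y \<longrightarrow> int x - int y > 2)" for x y
  proof -
    have "x \<noteq> y + 2" if "odd x" "even y" using that by auto
    then show ?thesis by (cases "x = y + 2") (auto simp: gap_def)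
  qed
  have "gap_condition xs \<longleftrightarrow> (\<forall>i. Suc i < length xs \<longrightarrow> gap (xs ! i) (xs ! Suc i))"
    unfolding gap_condition_def gap ..
  also have "\<dots> \<longleftrightarrow> successively gap xs"
  proof (induction xs rule: induct_list012)
    case (3 x y zs)
    show ?case using 3(2) by (simp add: All_less_Suc2)
  qed auto
  finally show ?thesis .
qed

lemma gap_from_iff:
  "gap_from m xs \<longleftrightarrow> (xs = [] \<or> m \<le> hd xs) \<and> successively (\<lambda>x y. gap y x) xs"
  by (induction xs arbitrary: m) (auto simp: successively_Cons gap_def)

lemma gap_from_sorted: "gap_from m xs \<Longrightarrow> sorted xs \<and> (\<forall>x\<in>set xs. m \<le> x)"
  by (induction xs arbitrary: m) (fastforce split: if_splits)+

lemma length_partition_le: "xs \<in> partitions n \<Longrightarrow> length xs \<le> n"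
proof -
  have "length xs \<le> sum_list xs" if "\<forall>x\<in>set xs. x > 0" for xs :: "nat list"
    using that by (induction xs) auto
  then show "xs \<in> partitions n \<Longrightarrow> length xs \<le> n" by (auto simp: partitions_def)
qed

lemma gap_partitions_eq:
  assumes "n \<le> N"
  shows "{xs \<in> partitions n. gap_condition xs} = rev ` gap_lists N 0 n"
proof (intro set_eqI iffI)
  fix xs assume "xs \<in> rev ` gap_lists N 0 n"
  then obtain ys where "xs = rev ys" "gap_from 1 ys" "sum_list ys = n" by (auto simp: gap_lists_def)
  then show "xs \<in> {xs \<in> partitions n. gap_condition xs}"
    using gap_from_sorted[of 1 ys] gap_from_iff[of 1 ys]
    by (auto simp: partitions_def gap_condition_iff sorted_wrt_rev Suc_le_eq)
next
  fix xs assume xs: "xs \<in> {xs \<in> partitions n. gap_condition xs}"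
  then have "rev xs = [] \<or> 1 \<le> hd (rev xs)"
    by (cases xs rule: rev_cases) (auto simp: partitions_def)
  then have "gap_from 1 (rev xs)"
    unfolding gap_from_iff using xs by (simp add: gap_condition_iff)
  then have "rev xs \<in> gap_lists N 0 n"
    using xs length_partition_le[of xs n] assms by (simp add: gap_lists_def partitions_def)
  then have "rev (rev xs) \<in> rev ` gap_lists N 0 n" by (rule imageI)
  then show "xs \<in> rev ` gap_lists N 0 n" by simp
qed

lemma card_gap_partitions:
  assumes "n \<le> N"
  shows "card {xs \<in> partitions n. gap_condition xs} = card (gap_lists N 0 n)"
  unfolding gap_partitions_eq[OF assms] by (rule card_image) (simp add: inj_on_def)

section \<open>Partitions into parts from a given set\<close>

text \<open>
  Multisets carry the operations needed below, insertion and removal of copies of a part, without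
  regard to where these would stand in a decreasing list.
\<close>

lemma bij_betw_mset_partitions:
  "bij_betw mset (partitions n) {A. 0 \<notin># A \<and> sum_mset A = n}"
proof (rule bij_betw_imageI)
  show "inj_on mset (partitions n)"
  proof (rule inj_onI)
    fix xs ys assume "xs \<in> partitions n" "ys \<in> partitions n" "mset xs = mset ys"
    then have "sort (rev xs) = rev xs" "sort (rev ys) = rev ys" "mset (rev xs) = mset (rev ys)"
      by (auto simp: partitions_def sorted_sort_id sorted_wrt_rev)
    then have "rev xs = rev ys" using sorted_list_of_multiset_mset[of "rev xs"] sorted_list_of_multiset_mset[of "rev ys"] by simp
    then show "xs = ys" by simp
  qed
  show "mset ` partitions n = {A. 0 \<notin># A \<and> sum_mset A = n}"
  proof (intro set_eqI iffI)
    fix A assume "A \<in> {A. 0 \<notin># A \<and> sum_mset A = n}"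
    moreover define xs where "xs = rev (sorted_list_of_multiset A)"
    moreover have A: "mset xs = A" by (simp add: xs_def)
    ultimately have "xs \<in> partitions n"
      by (auto simp: partitions_def sorted_wrt_rev sum_mset_sum_list[symmetric] intro: gr0I)
    then show "A \<in> mset ` partitions n" using A by blast
  qed (auto simp: partitions_def sum_mset_sum_list)
qed

lemma card_partitions_mset:
  "card {xs \<in> partitions n. P (mset xs)} = card {A. 0 \<notin># A \<and> sum_mset A = n \<and> P A}"
proof (rule bij_betw_same_card[of mset], rule bij_betw_imageI)
  have inj: "inj_on mset (partitions n)" and img: "mset ` partitions n = {A. 0 \<notin># A \<and> sum_mset A = n}"
    using bij_betw_mset_partitions[of n] unfolding bij_betw_def by simp_all
  show "inj_on mset {xs \<in> partitions n. P (mset xs)}"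
    using inj by (rule inj_on_subset) blast
  have "mset ` {xs \<in> partitions n. P (mset xs)} = {A \<in> mset ` partitions n. P A}" by blast
  then show "mset ` {xs \<in> partitions n. P (mset xs)} = {A. 0 \<notin># A \<and> sum_mset A = n \<and> P A}"
    unfolding img by simp
qed

lemma finite_multisets_sum: "finite {A :: nat multiset. 0 \<notin># A \<and> sum_mset A = n}"
  using bij_betw_finite[OF bij_betw_mset_partitions[of n]] finite_partitions[of n] by simp

definition parts_in :: "nat set \<Rightarrow> nat \<Rightarrow> nat multiset set" where
  "parts_in J n = {A. set_mset A \<subseteq> J \<and> sum_mset A = n}"

lemma finite_parts_in: "0 \<notin> J \<Longrightarrow> finite (parts_in J n)"
  by (rule finite_subset[OF _ finite_multisets_sum[of n]]) (auto simp: parts_in_def)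

text \<open>
  Either j does not occur, or one copy of it can be removed.
\<close>

lemma card_parts_in_insert:
  assumes "0 \<notin> insert j J" "j \<notin> J"
  shows "card (parts_in (insert j J) n) = card (parts_in J n) + (if n < j then 0 else card (parts_in (insert j J) (n - j)))"
proof -
  let ?B = "if n < j then {} else add_mset j ` parts_in (insert j J) (n - j)"
  have "parts_in (insert j J) n = parts_in J n \<union> ?B"
  proof (intro set_eqI iffI)
    fix A assume A: "A \<in> parts_in (insert j J) n"
    show "A \<in> parts_in J n \<union> ?B"
    proof (cases "j \<in># A")
      case True
      then obtain B where B: "A = add_mset j B" by (metis multi_member_split)
      then have "B \<in> parts_in (insert j J) (n - j)" "\<not> n < j" using A by (auto simp: parts_in_def)
      then show ?thesis using B by auto
    qed (use A in \<open>auto simp: parts_in_def\<close>)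
  qed (auto simp: parts_in_def split: if_splits)
  moreover have "parts_in J n \<inter> ?B = {}"
  proof -
    have "j \<notin># A" if "A \<in> parts_in J n" for A
      using that assms(2) unfolding parts_in_def by blast
    moreover have "j \<in># A" if "A \<in> ?B" for A
      using that by (cases "n < j") (simp_all, elim imageE, simp)
    ultimately show ?thesis by blast
  qed
  moreover have "card ?B = (if n < j then 0 else card (parts_in (insert j J) (n - j)))"
    by (simp add: card_image inj_on_def)
  moreover have "finite (parts_in J n)" "finite ?B"
    using assms finite_parts_in by auto
  ultimately show ?thesis by (simp add: card_Un_disjoint)
qed

definition parts_series :: "nat set \<Rightarrow> rat fps" where
  "parts_series J = Abs_fps (\<lambda>n. of_nat (card (parts_in J n)))"

text \<open>
  Euler's product for the generating function of partitions into parts from a finite set.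
\<close>

lemma parts_series_product:
  assumes "finite J" "0 \<notin> J"
  shows "parts_series J * (\<Prod>j\<in>J. 1 - fps_X ^ j) = 1"
  using assms
proof (induction J)
  case empty
  have "parts_in {} n = (if n = 0 then {{#}} else {})" for n by (auto simp: parts_in_def)
  then show ?case by (simp add: parts_series_def fps_eq_iff)
next
  case (insert j J)
  have "parts_series (insert j J) = parts_series J + fps_X ^ j * parts_series (insert j J)"
    using card_parts_in_insert[of j J] insert by (simp add: parts_series_def fps_eq_iff fps_X_power_mult_nth)
  then have "parts_series (insert j J) * (1 - fps_X ^ j) = parts_series J"
    by (simp add: algebra_simps)
  then show ?case using insert by (simp add: mult.assoc[symmetric])
qed

lemma residue_product_eq:
  "residue_product N = (\<Prod>j | j < 8 * N \<and> j mod 8 \<in> {1, 4, 7}. 1 - fps_X ^ j)"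
proof (induction N)
  case (Suc N)
  let ?J = "\<lambda>N. {j. j < 8 * N \<and> j mod 8 \<in> {1, 4, 7::nat}}"
  have *: "?J (Suc N) = insert (8 * N + 1) (insert (8 * N + 4) (insert (8 * N + 7) (?J N)))"
  proof (rule set_eqI)
    fix j :: nat
    have less: "j < 8 * K \<longleftrightarrow> j div 8 < K" for K :: nat
      by (simp add: div_less_iff_less_mult mult.commute)
    have eq: "j = 8 * N + r \<longleftrightarrow> j div 8 = N \<and> j mod 8 = r" if "r < 8" for r
      using that mult_div_mod_eq[of 8 j] by auto
    show "j \<in> ?J (Suc N) \<longleftrightarrow> j \<in> insert (8 * N + 1) (insert (8 * N + 4) (insert (8 * N + 7) (?J N)))"
      unfolding mem_Collect_eq insert_iff less by (subst (1 2 3) eq) (auto simp: less_Suc_eq)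
  qed
  have "finite (?J N)" by (rule finite_subset[of _ "{..<8 * N}"]) auto
  then have "(\<Prod>j\<in>?J (Suc N). 1 - fps_X ^ j) = (1 - fps_X ^ (8 * N + 1)) * ((1 - fps_X ^ (8 * N + 4)) *
      ((1 - fps_X ^ (8 * N + 7)) * (residue_product N)))"
    unfolding * Suc by simp
  moreover have "fps_X ^ (8 * N + c) = (fps_X ^ c * (fps_X ^ 8) ^ N :: rat fps)" for c
    unfolding power_add power_mult by (rule mult.commute)
  ultimately show ?case
    by (simp only: residue_product_def qpoch_Suc power_one_right ac_simps)
qed (simp add: residue_product_def)

section \<open>The Goellnitz-Gordon identity\<close>

text \<open>
  The generating functions of both kinds of partitions are inverse to \<open>residue_product\<close> modulo X^N, hence
  congruent to each other.
\<close>

lemma goellnitz_gordon: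
  "card {xs \<in> partitions n. parts_1_4_7_mod_8 xs} = card {xs \<in> partitions n. gap_condition xs}"
proof -
  (* a precision that includes the coefficient of X^n and a range 8N that includes all parts up to n *)
  define N where "N = Suc n"
  let ?J = "{j. j < 8 * N \<and> j mod 8 \<in> {1, 4, 7::nat}}"
  have fin: "finite ?J" by (rule finite_subset[of _ "{..<8 * N}"]) auto
  have F: "parts_series ?J * residue_product N = 1"
    using parts_series_product[OF fin] by (simp add: residue_product_eq)
  have "xcong N (gg_sum N 0 * residue_product N * parts_series ?J) (1 * parts_series ?J)"
    by (intro xcong_mult xcong_refl gg_product)
  moreover have "gg_sum N 0 * residue_product N * parts_series ?J = gg_sum N 0 * (parts_series ?J * residue_product N)"
    by (simp only: ac_simps)
  ultimately have "xcong N (gg_sum N 0) (parts_series ?J)" by (simp only: F mult_1_left mult_1_right)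
  then have "fps_nth (gg_sum N 0) n = fps_nth (parts_series ?J) n"
    by (rule xcong_nth) (simp add: N_def)
  then have "card (gap_lists N 0 n) = card (parts_in ?J n)"
    unfolding gg_sum_nth parts_series_def by simp
  moreover have "parts_in ?J n = {A. 0 \<notin># A \<and> sum_mset A = n \<and> (\<forall>x\<in>#A. x mod 8 \<in> {1, 4, 7})}"
  proof -
    have "x < 8 * N" if "x \<in># A" "sum_mset A = n" for x A
    proof -
      have "x \<le> sum_mset A" using that(1) by (metis le_add1 multi_member_split sum_mset.add_mset)
      then show ?thesis using that(2) by (simp add: N_def)
    qed
    then show ?thesis unfolding parts_in_def by fastforce
  qed
  ultimately show ?thesis
    using card_gap_partitions[of n N] card_partitions_mset[of n "\<lambda>A. \<forall>x\<in>#A. x mod 8 \<in> {1, 4, 7}"]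
    by (simp add: N_def parts_1_4_7_mod_8_def)
qed

section \<open>Refinement by the multiplicity of one part\<close>

lemma card_eq_level:
  assumes "finite S"
  shows "card {x \<in> S. f x = (k::nat)} = card {x \<in> S. k \<le> f x} - card {x \<in> S. Suc k \<le> f x}"
proof -
  have "{x \<in> S. f x = k} = {x \<in> S. k \<le> f x} - {x \<in> S. Suc k \<le> f x}" by auto
  moreover have "card ({x \<in> S. k \<le> f x} - {x \<in> S. Suc k \<le> f x}) = card {x \<in> S. k \<le> f x} - card {x \<in> S. Suc k \<le> f x}"
    using assms by (intro card_Diff_subset) auto
  ultimately show ?thesis by simp
qed

text \<open>
  Removing k copies of M is a bijection because M itself is an admissible part.
\<close>

lemma card_count_ge:
  assumes "M > 0" "M mod 8 \<in> {1, 4, 7}"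
  shows "card {xs \<in> partitions n. parts_1_4_7_mod_8 xs \<and> k \<le> count_list xs M}
    = (if k * M \<le> n then card {xs \<in> partitions (n - k * M). parts_1_4_7_mod_8 xs} else 0)"
proof -
  let ?R = "\<lambda>A. \<forall>x\<in>#A. x mod 8 \<in> {1, 4, 7::nat}"
  let ?S = "{A. 0 \<notin># A \<and> sum_mset A = n \<and> ?R A \<and> k \<le> count A M}"
  let ?T = "{A. 0 \<notin># A \<and> sum_mset A = n - k * M \<and> ?R A}"
  have "?S = (if k * M \<le> n then (\<lambda>A. A + replicate_mset k M) ` ?T else {})"
  proof (intro set_eqI iffI)
    fix A assume A: "A \<in> ?S"
    then have "replicate_mset k M \<subseteq># A" by (simp add: count_le_replicate_mset_subset_eq)
    then obtain B where B: "A = B + replicate_mset k M" by (metis subset_mset.le_iff_add add.commute)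
    then have "B \<in> ?T" "k * M \<le> n" using A by auto
    then show "A \<in> (if k * M \<le> n then (\<lambda>A. A + replicate_mset k M) ` ?T else {})" using B by auto
  qed (use assms in \<open>auto split: if_splits\<close>)
  moreover have "inj_on (\<lambda>A. A + replicate_mset k M) ?T" by (simp add: inj_on_def)
  ultimately have "card ?S = (if k * M \<le> n then card ?T else 0)" by (simp add: card_image)
  moreover have "card {xs \<in> partitions n. parts_1_4_7_mod_8 xs \<and> k \<le> count_list xs M} = card ?S"
    using card_partitions_mset[of n "\<lambda>A. ?R A \<and> k \<le> count A M"]
    by (simp only: parts_1_4_7_mod_8_def set_mset_mset count_mset)
  moreover have "card {xs \<in> partitions (n - k * M). parts_1_4_7_mod_8 xs} = card ?T"
    using card_partitions_mset[of "n - k * M" ?R] by (simp only: parts_1_4_7_mod_8_def set_mset_mset)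
  ultimately show ?thesis by (simp only:)
qed

text \<open>
  The amount by which the largest part exceeds the least value that the second part
  permits; for a single part, the part itself, as it may be removed altogether.
\<close>

fun excess :: "nat list \<Rightarrow> nat" where
  "excess [] = 0"
| "excess [x] = x"
| "excess (x # y # zs) = x - (y + (if even y then 3 else 2))"

text \<open>
  The empty partition counts as having the largest part 0.
\<close>

fun raise_first :: "nat \<Rightarrow> nat list \<Rightarrow> nat list" where
  "raise_first d [] = [d]"
| "raise_first d (x # xs) = (x + d) # xs"

text \<open>
  The largest part can be lowered by d precisely when the excess is at least d.  Equality for a single part
  leads to the empty partition; n \<ge> 1 excludes the empty partition on the left, which has no part to lower.
\<close>

lemma raise_first_image:
  assumes "n \<ge> 1" "d \<le> n"
  shows "{xs \<in> partitions n. gap_condition xs \<and> d \<le> excess xs} = raise_first d ` {xs \<in> partitions (n - d). gap_condition xs}"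
    (is "?S = _ ` ?T")
proof (intro set_eqI iffI)
  fix xs assume xs: "xs \<in> ?S"
  show "xs \<in> raise_first d ` ?T"
  proof (cases xs rule: excess.cases)
    case 1
    then show ?thesis using xs assms by (simp add: partitions_def)
  next
    case (2 x)
    then have "x = n" using xs by (simp add: partitions_def)
    show ?thesis
    proof (cases "d = n")
      case True
      then show ?thesis using 2 \<open>x = n\<close>
        by (intro image_eqI[of _ _ "[]"]) (auto simp: partitions_def gap_condition_iff)
    next
      case False
      then show ?thesis using 2 \<open>x = n\<close> assms
        by (intro image_eqI[of _ _ "[n - d]"]) (auto simp: partitions_def gap_condition_iff)
    qed
  next
    case (3 x y zs)
    have "d \<le> x - (y + (if even y then 3 else 2))" "gap x y"
      using xs 3 by (auto simp: gap_condition_iff)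
    then have g: "gap (x - d) y" and d: "d \<le> x" by (auto simp: gap_def)
    then have "y \<le> x - d" by (auto simp: gap_def)
    then have "(x - d) # y # zs \<in> ?T"
      using xs 3 g d by (auto simp: partitions_def gap_condition_iff)
    then show ?thesis using 3 d by (intro image_eqI[of _ _ "(x - d) # y # zs"]) auto
  qed
next
  fix xs assume "xs \<in> raise_first d ` ?T"
  then obtain ys where ys: "ys \<in> ?T" "xs = raise_first d ys" by auto
  then show "xs \<in> ?S"
    using assms by (cases ys rule: excess.cases) (auto simp: partitions_def gap_condition_iff gap_def)
qed

lemma card_excess_ge:
  assumes "n \<ge> 1"
  shows "card {xs \<in> partitions n. gap_condition xs \<and> d \<le> excess xs}
    = (if d \<le> n then card {xs \<in> partitions (n - d). gap_condition xs} else 0)"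
proof (cases "d \<le> n")
  case True
  have "inj_on (raise_first d) {xs \<in> partitions (n - d). gap_condition xs}"
  proof (rule inj_onI)
    fix xs ys assume "xs \<in> {xs \<in> partitions (n - d). gap_condition xs}" "ys \<in> {xs \<in> partitions (n - d). gap_condition xs}"
      "raise_first d xs = raise_first d ys"
    then show "xs = ys" by (cases xs; cases ys) (auto simp: partitions_def)
  qed
  then show ?thesis using True by (simp add: raise_first_image[OF assms True] card_image)
next
  case False
  have "excess xs \<le> sum_list xs" for xs by (cases xs rule: excess.cases) auto
  then have "{xs \<in> partitions n. gap_condition xs \<and> d \<le> excess xs} = {}"
    using False by (fastforce simp: partitions_def dest: le_trans)
  then show ?thesis using False by (simp only: card.empty if_False)
qed

text \<open>
  The gap condition makes the numerators non-negative, so the real floors are quotients of natural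
  numbers.
\<close>

lemma excess_condition_iff:
  assumes "xs \<in> partitions n" "gap_condition xs" "n \<ge> 1" "M > 0"
  shows "((length xs = 1 \<longrightarrow> \<lfloor>real n / real M\<rfloor> = int k) \<and>
      (length xs \<ge> 2 \<and> even (xs ! 1) \<longrightarrow>
         \<lfloor>(real (xs ! 0) - real (xs ! 1) - 3) / real M\<rfloor> = int k) \<and>
      (length xs \<ge> 2 \<and> odd (xs ! 1) \<longrightarrow>
         \<lfloor>(real (xs ! 0) - real (xs ! 1) - 2) / real M\<rfloor> = int k)) \<longleftrightarrow> excess xs div M = k"
proof (cases xs rule: excess.cases)
  case 1
  then show ?thesis using assms by (simp add: partitions_def)
next
  case (2 x)
  then show ?thesis using assms by (simp add: partitions_def floor_divide_of_nat_eq)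
next
  case (3 x y zs)
  have "gap x y" using assms(2) 3 by (simp add: gap_condition_iff)
  then have "even y \<Longrightarrow> real x - real y - 3 = real (excess xs)" "odd y \<Longrightarrow> real x - real y - 2 = real (excess xs)"
    unfolding 3 by (simp_all add: gap_def of_nat_diff)
  then show ?thesis unfolding 3 by (auto simp: floor_divide_of_nat_eq)
qed

theorem theorem3p12:
  fixes M n k :: nat
  assumes "M > 0"
    and "M mod 8 \<in> {1, 4, 7}"
    and "n \<ge> 1"
  shows "card {xs \<in> partitions n. parts_1_4_7_mod_8 xs \<and> count_list xs M = k} =
    card {xs \<in> partitions n. gap_condition xs \<and>
      (length xs = 1 \<longrightarrow> \<lfloor>real n / real M\<rfloor> = int k) \<and>
      (length xs \<ge> 2 \<and> even (xs ! 1) \<longrightarrow>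
         \<lfloor>(real (xs ! 0) - real (xs ! 1) - 3) / real M\<rfloor> = int k) \<and>
      (length xs \<ge> 2 \<and> odd (xs ! 1) \<longrightarrow>
         \<lfloor>(real (xs ! 0) - real (xs ! 1) - 2) / real M\<rfloor> = int k)}"
    (is "?L = card ?R")
proof -
  have ge: "card {xs \<in> partitions n. parts_1_4_7_mod_8 xs \<and> j \<le> count_list xs M}
    = card {xs \<in> partitions n. gap_condition xs \<and> j \<le> excess xs div M}" for j
    unfolding card_count_ge[OF assms(1,2)] less_eq_div_iff_mult_less_eq[OF assms(1)]
      card_excess_ge[OF assms(3)] goellnitz_gordon ..
  have "?R = {xs \<in> partitions n. gap_condition xs \<and> excess xs div M = k}"
    using excess_condition_iff[OF _ _ assms(3,1), of _ k] by blast
  then show ?thesis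
    using ge[of k] ge[of "Suc k"]
      card_eq_level[of "{xs \<in> partitions n. parts_1_4_7_mod_8 xs}" "\<lambda>xs. count_list xs M" k]
      card_eq_level[of "{xs \<in> partitions n. gap_condition xs}" "\<lambda>xs. excess xs div M" k]
    by (simp add: finite_partitions conj_assoc)
qed

end
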